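(* Let $0\le k<K$ and let $A_k$ be an active set that is circularly optimal and was produced by $k$ successive cell selections. Let $\mathfrak C_k$ be the set of current candidate cells with respect to $A_k$. Then $$C_{k+1}^{\circ}-C_k^{\circ}=\min_{\mathcal C\in\mathfrak C_k}\mathfrak m(\mathcal C),$$ and activating the two endpoints of any minimizing cell yields a circularly optimal active set $A_{k+1}$.
   Context: Fix $L>0$, $w>0$ and integers $n,m\ge 1$. The circle is $\mathbb{S}^1_L=\mathbb{R}/L\mathbb{Z}$ with geodesic distance $d(x,y)=\min\{|x-y|,\,L-|x-y|\}$ for coordinates in $[0,L)$; clockwise means in the direction of increasing coordinate. Let $x_1,\dots,x_n$ (source atoms) and $y_1,\dots,y_m$ (target atoms) be pairwise distinct points of the circle, each of mass $w$; $N=n+m$, $K=\min(n,m)$. A matching $M$ is a set of pairs $(x_i,y_j)$ in which no atom appears twice; its cost is $w\sum_{(x_i,y_j)\in M}d(x_i,y_j)$, and $C_k^\circ$ is the minimum cost over matchings with $|M|=k$. The active set of $M$ is the set of atoms incident to $M$. A set $A$ of $k$ source and $k$ target atoms is circularly optimal if it is the active set of some matching with $|M|=k$ and cost $C_k^\circ$. Cells. Given an active set $A$, let $u_1,\dots,u_r$ ($r\ge1$) be the inactive atoms (those not in $A$) in clockwise cyclic order, $u_{r+1}=u_1$. The current cells with respect to $A$ are the $r$ closed clockwise arcs from $u_i$ to $u_{i+1}$ (for $r=2$ these are the two complementary arcs; for $r=1$ the single cell is the whole circle traversed once from $u_1$ to itself). A current cell is a candidate if its endpoints are of opposite type (one source,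 one target). Selections. Successive cell selections start from $A_0=\varnothing$; at step $j\ge 1$ a cell that is a candidate with respect to $A_{j-1}$ is selected and its endpoints $u,v$ are activated: $A_j=A_{j-1}\cup\{u,v\}$. For active sets so produced, the active atoms in the interior of every current cell contain equally many sources and targets. Marginal. For a finite set $P$ of points on a line consisting of $j$ sources $x_{(1)}<\dots<x_{(j)}$ and $j$ targets $y_{(1)}<\dots<y_{(j)}$, put $c_{\mathbb R}(P)=w\sum_{i=1}^j|x_{(i)}-y_{(i)}|$. For a candidate cell $\mathcal C$ from $u$ clockwise to $v$, place each atom of $\mathcal C$ on the line at its clockwise arc-length distance from $u$. Let $\mathcal C^\circ$ denote the (active) atoms in the open arc. The local marginal is $\mathfrak m(\mathcal C)=c_{\mathbb R}(\mathcal C^\circ\cup\{u,v\})-c_{\mathbb R}(\mathcal C^\circ)$. *)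

theory Defs
  imports Complex_Main
begin

text \<open>A point of the circle of circumference L is represented by its coordinate in {0..<L};
  X is the set of sources, Y the set of targets, A a set of active atoms.\<close>

definition circ_dist :: "real \<Rightarrow> real \<Rightarrow> real \<Rightarrow> real" where
  "circ_dist L x y = min \<bar>x - y\<bar> (L - \<bar>x - y\<bar>)"

definition is_matching :: "real set \<Rightarrow> real set \<Rightarrow> (real \<times> real) set \<Rightarrow> bool" where
  "is_matching X Y M \<longleftrightarrow> M \<subseteq> X \<times> Y \<and> inj_on fst M \<and> inj_on snd M"

definition matching_cost :: "real \<Rightarrow> real \<Rightarrow> (real \<times> real) set \<Rightarrow> real" where
  "matching_cost L w M = w * (\<Sum>(x, y)\<in>M. circ_dist L x y)"

definition opt_cost :: "real \<Rightarrow> real \<Rightarrow> real set \<Rightarrow> real set \<Rightarrow> nat \<Rightarrow> real" where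
  "opt_cost L w X Y k = Min {matching_cost L w M | M. is_matching X Y M \<and> card M = k}"

definition active_set :: "(real \<times> real) set \<Rightarrow> real set" where
  "active_set M = fst ` M \<union> snd ` M"

definition circ_optimal ::
  "real \<Rightarrow> real \<Rightarrow> real set \<Rightarrow> real set \<Rightarrow> nat \<Rightarrow> real set \<Rightarrow> bool" where
  "circ_optimal L w X Y k A \<longleftrightarrow>
     A \<subseteq> X \<union> Y \<and> card (A \<inter> X) = k \<and> card (A \<inter> Y) = k \<and>
     (\<exists>M. is_matching X Y M \<and> card M = k \<and> active_set M = A \<and>
          matching_cost L w M = opt_cost L w X Y k)"

text \<open>Clockwise arc length from u to p, with value 0 for p = u.\<close>

definition cw_dist :: "real \<Rightarrow> real \<Rightarrow> real \<Rightarrow> real" where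
  "cw_dist L u p = (if u \<le> p then p - u else p - u + L)"

text \<open>The arc from u to u is the whole circle traversed once, so its interior
  is everything except u.\<close>

definition open_arc :: "real \<Rightarrow> real \<Rightarrow> real \<Rightarrow> real set" where
  "open_arc L u v = {p \<in> {0..<L}. p \<noteq> u \<and> (u = v \<or> cw_dist L u p < cw_dist L u v)}"

text \<open>A cell is encoded by its ordered pair (u, v) of endpoints, standing for the closed
  clockwise arc from u to v.  The two arcs between two inactive atoms are thus (u, v) and (v, u).
  A pair (u, u) is a cell only if u is the single inactive atom.\<close>

definition cells :: "real \<Rightarrow> real set \<Rightarrow> real set \<Rightarrow> real set \<Rightarrow> (real \<times> real) set" where
  "cells L X Y A = {(u, v). u \<in> X \<union> Y - A \<and> v \<in> X \<union> Y - A \<and>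
                            open_arc L u v \<inter> (X \<union> Y - A) = {}}"

definition candidate_cells ::
  "real \<Rightarrow> real set \<Rightarrow> real set \<Rightarrow> real set \<Rightarrow> (real \<times> real) set" where
  "candidate_cells L X Y A =
     {(u, v) \<in> cells L X Y A. u \<in> X \<and> v \<in> Y \<or> u \<in> Y \<and> v \<in> X}"

inductive cell_selection :: "real \<Rightarrow> real set \<Rightarrow> real set \<Rightarrow> nat \<Rightarrow> real set \<Rightarrow> bool"
  for L X Y where
  start: "cell_selection L X Y 0 {}"
| select: "cell_selection L X Y j A \<Longrightarrow> (u, v) \<in> candidate_cells L X Y A \<Longrightarrow>
     cell_selection L X Y (Suc j) (A \<union> {u, v})"

text \<open>S and T are the source and target parts of a point set on the line; the value is
  meaningful when both are finite with the same number of elements.\<close>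

definition line_cost :: "real \<Rightarrow> real set \<Rightarrow> real set \<Rightarrow> real" where
  "line_cost w S T =
     w * (\<Sum>i<card S. \<bar>sorted_list_of_set S ! i - sorted_list_of_set T ! i\<bar>)"

definition unrolled_cost ::
  "real \<Rightarrow> real \<Rightarrow> real set \<Rightarrow> real set \<Rightarrow> real \<Rightarrow> real set \<Rightarrow> real" where
  "unrolled_cost L w X Y u P = line_cost w (cw_dist L u ` (P \<inter> X)) (cw_dist L u ` (P \<inter> Y))"

fun marginal ::
  "real \<Rightarrow> real \<Rightarrow> real set \<Rightarrow> real set \<Rightarrow> real set \<Rightarrow> real \<times> real \<Rightarrow> real" where
  "marginal L w X Y A (u, v) =
     unrolled_cost L w X Y u (A \<inter> open_arc L u v \<union> {u, v}) -
     unrolled_cost L w X Y u (A \<inter> open_arc L u v)"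

end

theory Submission
  imports Defs "HOL-Analysis.Analysis"
begin

text \<open>
  A perfect matching of balanced active atoms is priced by its clockwise flow: the cost is at least
  the integral over the circle of the absolute value of the net flow, and sorted matchings attain it.
  In an optimal matching no geodesic passes an inactive atom, so its flow F vanishes at all inactive
  atoms and the active atoms in every cell are balanced.

  Pushing one more unit clockwise from a source u to a target v costs the integral over the arc of
  the slope of |F|, which is 1 where F \<ge> 0 and -1 elsewhere. For adjacent inactive u and v this is
  the local marginal; this gives the upper bound. For the lower bound, an alternating path argument
  yields an optimal matching of k + 1 pairs whose active set adds just a source u and a target v to A.
  Its flow is F + 1 on the arc from u to v and F elsewhere, shifted by an integer; a nonnegative shift
  (otherwise exchange sources and targets) does not lower the cost. Between u and v, let v' be the
  first inactive target and u' the last inactive source before it. The pieces from u to u' and from v'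
  to v have nonnegative cost, since they amount to swapping an active atom for an inactive one of the
  same type, so the cell from u' to v' costs no more than the whole arc.
\<close>

section \<open>Integration over the circle\<close>

text \<open>Lebesgue measure on the coordinate interval. Its invariance under rotations enters only
  through \<open>integral_less\<close>.\<close>

definition circle :: "real \<Rightarrow> real measure" where
  "circle L = restrict_space lborel {0..<L}"

lemma space_circle [simp]: "space (circle L) = {0..<L}"
  by (simp add: circle_def space_restrict_space)

lemma emeasure_circle: "E \<in> sets borel \<Longrightarrow> E \<subseteq> {0..<L} \<Longrightarrow> emeasure (circle L) E = emeasure lborel E"
  by (simp add: circle_def emeasure_restrict_space)

text \<open>The flows and the integrands built from them take finitely many values on a space of
  finite measure; this is the source of all integrability facts below.\<close>

lemma integrable_step:
  fixes f :: "real \<Rightarrow> real"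
  assumes "simple_function (circle L) f"
  shows "integrable (circle L) f"
proof (rule integrable_simple_function[OF assms])
  have "emeasure (circle L) {y \<in> space (circle L). f y \<noteq> 0} \<le> emeasure (circle L) (space (circle L))"
    by (rule emeasure_space)
  also have "\<dots> = emeasure lborel {0..<L}"
    by (simp add: emeasure_circle)
  also have "\<dots> < \<infinity>"
    by (cases "0 \<le> L") auto
  finally show "emeasure (circle L) {y \<in> space (circle L). f y \<noteq> 0} \<noteq> \<infinity>"
    by simp
qed

lemma cw_dist_measurable [measurable]: "cw_dist L u \<in> borel_measurable (circle L)"
  unfolding cw_dist_def[abs_def] circle_def by (rule measurable_restrict_space1) measurable

lemma step_of_bool:
  "Measurable.pred (circle L) P \<Longrightarrow> simple_function (circle L) (\<lambda>t. of_bool (P t) :: real)"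
  unfolding of_bool_def by (intro simple_function_If simple_function_const) (simp add: pred_def)

lemma step_ge: "simple_function (circle L) (\<lambda>t. of_bool (z \<le> cw_dist L u t) :: real)"
  by (rule step_of_bool) measurable

lemma cw_dist_range: "u \<in> {0..<L} \<Longrightarrow> t \<in> {0..<L} \<Longrightarrow> cw_dist L u t \<in> {0..<L}"
  by (auto simp: cw_dist_def)

text \<open>An arc of length \<open>b\<close> from \<open>u\<close> is one interval or, if it passes
  the coordinate 0, two disjoint ones.\<close>

lemma integral_less:
  assumes u: "u \<in> {0..<L}" and b: "b \<in> {0..L}"
  shows "(\<integral>t. of_bool (cw_dist L u t < b) \<partial>circle L) = b"
proof -
  define E where "E = (if u + b \<le> L then {u..<u + b} else {u..<L} \<union> {0..<u + b - L})"
  have E: "E \<in> sets borel" "E \<subseteq> {0..<L}"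
    using u b by (auto simp: E_def)
  have "emeasure lborel E = ennreal b"
  proof (cases "u + b \<le> L")
    case False
    have "emeasure lborel ({u..<L} \<union> {0..<u + b - L}) = ennreal (L - u) + ennreal (u + b - L)"
      using u b False by (subst plus_emeasure[symmetric]) auto
    then show ?thesis
      using u b False by (simp add: E_def flip: ennreal_plus)
  qed (use b in \<open>simp add: E_def\<close>)
  then have "measure (circle L) E = b"
    using E b by (simp add: measure_def emeasure_circle)
  moreover have "(\<integral>t. of_bool (cw_dist L u t < b) \<partial>circle L) = (\<integral>t. (indicator E t :: real) \<partial>circle L)"
  proof (rule Bochner_Integration.integral_cong)
    fix t assume "t \<in> space (circle L)"
    then have "cw_dist L u t < b \<longleftrightarrow> t \<in> E"
      using u b by (auto simp: E_def cw_dist_def)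
    then show "(of_bool (cw_dist L u t < b) :: real) = indicator E t"
      by (simp add: indicator_def)
  qed simp
  moreover have "E \<inter> {0..<L} = E"
    using E by auto
  ultimately show ?thesis
    by simp
qed

text \<open>The integrand is the indicator of the arc between the positions \<open>a\<close> and
  \<open>b\<close>. The position \<open>L\<close> is allowed because \<open>swap_target\<close>
  places an atom at the far end of the unrolled circle.\<close>

lemma integral_abs_diff:
  assumes u: "u \<in> {0..<L}" and a: "a \<in> {0..L}" and b: "b \<in> {0..L}"
  shows "(\<integral>t. \<bar>of_bool (a \<le> cw_dist L u t) - of_bool (b \<le> cw_dist L u t)\<bar> \<partial>circle L) = \<bar>a - b\<bar>"
proof -
  have s: "integrable (circle L) (\<lambda>t. of_bool (cw_dist L u t < c) :: real)" for c
    by (intro integrable_step step_of_bool) measurable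
  have *: "(\<integral>t. \<bar>of_bool (a \<le> cw_dist L u t) - of_bool (b \<le> cw_dist L u t)\<bar> \<partial>circle L) = b - a"
    if "a \<le> b" "a \<in> {0..L}" "b \<in> {0..L}" for a b
  proof -
    have "(\<integral>t. \<bar>of_bool (a \<le> cw_dist L u t) - of_bool (b \<le> cw_dist L u t)\<bar> \<partial>circle L)
        = (\<integral>t. (of_bool (cw_dist L u t < b) - of_bool (cw_dist L u t < a) :: real) \<partial>circle L)"
      using that by (intro Bochner_Integration.integral_cong) auto
    then show ?thesis
      using u that by (simp add: s integral_less)
  qed
  show ?thesis
  proof (cases "a \<le> b")
    case False
    then show ?thesis
      using *[of b a] a b by (subst abs_minus_commute) simp
  qed (use *[of a b] a b in simp)
qed

section \<open>Sorted pairings on the line\<close>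

lemma sum_nth_sorted_list_of_set:
  assumes "finite S"
  shows "(\<Sum>i<card S. f (sorted_list_of_set S ! i)) = sum f S"
proof -
  have "bij_betw (\<lambda>i. sorted_list_of_set S ! i) {..<card S} S"
    using assms by (intro bij_betw_nth) auto
  then show ?thesis
    by (rule sum.reindex_bij_betw)
qed

text \<open>The two down-sets of indices are comparable, so all summands have the same sign.\<close>

lemma sum_abs_sorted_of_bool:
  fixes z :: real
  assumes "finite S" "finite T" "card S = card T"
  shows "(\<Sum>i<card S. \<bar>of_bool (sorted_list_of_set S ! i \<le> z) - of_bool (sorted_list_of_set T ! i \<le> z)\<bar>)
       = \<bar>(\<Sum>s\<in>S. of_bool (s \<le> z)) - (\<Sum>s\<in>T. of_bool (s \<le> z)) :: real\<bar>"
proof -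
  let ?x = "\<lambda>i. sorted_list_of_set S ! i" and ?y = "\<lambda>i. sorted_list_of_set T ! i"
  have mono: "sorted_list_of_set R ! i \<le> sorted_list_of_set R ! j"
    if "i \<le> j" "j < card R" for R :: "real set" and i j
    using that by (intro sorted_nth_mono) auto
  have "(\<forall>i<card S. ?x i \<le> z \<longrightarrow> ?y i \<le> z) \<or> (\<forall>i<card S. ?y i \<le> z \<longrightarrow> ?x i \<le> z)"
  proof (rule ccontr)
    assume "\<not> ?thesis"
    then obtain i j where "i < card S" "?x i \<le> z" "\<not> ?y i \<le> z" "j < card S" "?y j \<le> z" "\<not> ?x j \<le> z"
      by blast
    then show False
      using mono[of i j T] mono[of j i S] assms(3) by (cases "i \<le> j") auto
  qed
  then have "(\<Sum>i<card S. \<bar>of_bool (?x i \<le> z) - of_bool (?y i \<le> z)\<bar>)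
      = \<bar>\<Sum>i<card S. of_bool (?x i \<le> z) - of_bool (?y i \<le> z) :: real\<bar>"
  proof
    assume *: "\<forall>i<card S. ?x i \<le> z \<longrightarrow> ?y i \<le> z"
    then have "(\<Sum>i<card S. of_bool (?x i \<le> z) - of_bool (?y i \<le> z) :: real) \<le> 0"
      by (intro sum_nonpos) auto
    moreover have "(\<Sum>i<card S. \<bar>of_bool (?x i \<le> z) - of_bool (?y i \<le> z)\<bar>)
        = (\<Sum>i<card S. - (of_bool (?x i \<le> z) - of_bool (?y i \<le> z) :: real))"
      using * by (intro sum.cong) auto
    ultimately show ?thesis
      by (simp only: sum_negf)
  next
    assume *: "\<forall>i<card S. ?y i \<le> z \<longrightarrow> ?x i \<le> z"
    then have "(\<Sum>i<card S. of_bool (?x i \<le> z) - of_bool (?y i \<le> z) :: real) \<ge> 0"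
      by (intro sum_nonneg) auto
    moreover have "(\<Sum>i<card S. \<bar>of_bool (?x i \<le> z) - of_bool (?y i \<le> z)\<bar>)
        = (\<Sum>i<card S. of_bool (?x i \<le> z) - of_bool (?y i \<le> z) :: real)"
      using * by (intro sum.cong) auto
    ultimately show ?thesis
      by simp
  qed
  also have "(\<Sum>i<card S. of_bool (?x i \<le> z) - of_bool (?y i \<le> z) :: real)
      = (\<Sum>s\<in>S. of_bool (s \<le> z)) - (\<Sum>s\<in>T. of_bool (s \<le> z))"
    using sum_nth_sorted_list_of_set[OF assms(1), of "\<lambda>s. of_bool (s \<le> z) :: real"]
      sum_nth_sorted_list_of_set[OF assms(2), of "\<lambda>s. of_bool (s \<le> z) :: real"]
    by (simp add: sum_subtractf assms(3))
  finally show ?thesis .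
qed

text \<open>Each summand is an integral over thresholds. After exchanging sum and integral,
  \<open>sum_abs_sorted_of_bool\<close> pulls the absolute value out of the sum, which leaves the L1
  distance between the counting functions of \<open>S\<close> and \<open>T\<close>.\<close>

lemma line_cost_eq_integral:
  assumes u: "u \<in> {0..<L}" and fin: "finite S" "finite T" "card S = card T"
    and ST: "S \<subseteq> {0..L}" "T \<subseteq> {0..L}"
  shows "line_cost w S T = w * (\<integral>t. \<bar>(\<Sum>s\<in>S. of_bool (s \<le> cw_dist L u t)) -
           (\<Sum>s\<in>T. of_bool (s \<le> cw_dist L u t))\<bar> \<partial>circle L)"
proof -
  let ?x = "\<lambda>i. sorted_list_of_set S ! i" and ?y = "\<lambda>i. sorted_list_of_set T ! i"
  have "?x i \<in> {0..L}" "?y i \<in> {0..L}" if "i < card S" for i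
    using that fin ST nth_mem[of i "sorted_list_of_set S"] nth_mem[of i "sorted_list_of_set T"] by auto
  then have "(\<Sum>i<card S. \<bar>?x i - ?y i\<bar>)
      = (\<Sum>i<card S. \<integral>t. \<bar>of_bool (?x i \<le> cw_dist L u t) - of_bool (?y i \<le> cw_dist L u t)\<bar> \<partial>circle L)"
    by (intro sum.cong) (simp_all only: integral_abs_diff[OF u] lessThan_iff)
  also have "\<dots> = (\<integral>t. (\<Sum>i<card S. \<bar>of_bool (?x i \<le> cw_dist L u t) - of_bool (?y i \<le> cw_dist L u t)\<bar>) \<partial>circle L)"
    by (intro Bochner_Integration.integral_sum[symmetric] integrable_abs Bochner_Integration.integrable_diff
        integrable_step step_ge)
  also have "\<dots> = (\<integral>t. \<bar>(\<Sum>s\<in>S. of_bool (s \<le> cw_dist L u t)) -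
           (\<Sum>s\<in>T. of_bool (s \<le> cw_dist L u t))\<bar> \<partial>circle L)"
    by (simp only: sum_abs_sorted_of_bool[OF fin])
  finally show ?thesis
    unfolding line_cost_def by simp
qed

section \<open>Alternating paths\<close>

lemma inj_on_fst_insert: "inj_on fst M \<Longrightarrow> fst p \<notin> fst ` M \<Longrightarrow> inj_on fst (insert p M)"
  unfolding inj_on_insert by blast

lemma inj_on_snd_insert: "inj_on snd M \<Longrightarrow> snd p \<notin> snd ` M \<Longrightarrow> inj_on snd (insert p M)"
  unfolding inj_on_insert by blast

lemma inj_image_remove: "inj_on f M \<Longrightarrow> p \<in> M \<Longrightarrow> f ` (M - {p}) = f ` M - {f p}"
  by (auto simp: inj_on_def)

text \<open>Follows the alternating path that starts at u with an edge of N. The first alternative is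
  an augmenting path for M, the second one a path of even length.\<close>

lemma alternating_path_exchange:
  fixes M N :: "('a \<times> 'b) set"
  assumes "finite M" "inj_on fst M" "inj_on snd M" "inj_on fst N" "inj_on snd N"
    and "u \<in> fst ` N" "u \<notin> fst ` M"
  shows "\<exists>M' N'. M' \<union> N' = M \<union> N \<and> M' \<inter> N' = M \<inter> N \<and>
      inj_on fst M' \<and> inj_on snd M' \<and> inj_on fst N' \<and> inj_on snd N' \<and>
      ((\<exists>v. v \<in> snd ` N \<and> v \<notin> snd ` M \<and> fst ` M' = insert u (fst ` M) \<and> snd ` M' = insert v (snd ` M) \<and>
          fst ` N' = fst ` N - {u} \<and> snd ` N' = snd ` N - {v}) \<or>
       (\<exists>b. b \<in> fst ` M \<and> b \<notin> fst ` N \<and> fst ` M' = insert u (fst ` M) - {b} \<and> snd ` M' = snd ` M \<and>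
          fst ` N' = insert b (fst ` N) - {u} \<and> snd ` N' = snd ` N))"
  using assms
proof (induction "card M" arbitrary: M N u rule: less_induct)
  case (less M N u)
  obtain y where y: "(u, y) \<in> N"
    using less.prems by auto
  have rmN: "fst ` (N - {(u, y)}) = fst ` N - {u}" "snd ` (N - {(u, y)}) = snd ` N - {y}"
    using inj_image_remove[of fst N "(u, y)"] inj_image_remove[of snd N "(u, y)"] less.prems y by auto
  have yN: "y \<in> snd ` N"
    using y by force
  show ?case
  proof (cases "y \<in> snd ` M")
    \<comment> \<open>The path ends at once: \<open>y\<close> is free in \<open>M\<close>, and the
      edge from \<open>u\<close> to \<open>y\<close> changes sides.\<close>
    case False
    have "inj_on fst (insert (u, y) M)" "inj_on snd (insert (u, y) M)"
      using less.prems False by (simp_all add: inj_on_fst_insert inj_on_snd_insert del: inj_on_insert)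
    moreover have "inj_on fst (N - {(u, y)})" "inj_on snd (N - {(u, y)})"
      using less.prems by (auto intro: inj_on_subset)
    moreover have "(u, y) \<notin> M"
      using False by force
    moreover from this have "insert (u, y) M \<union> (N - {(u, y)}) = M \<union> N"
      "insert (u, y) M \<inter> (N - {(u, y)}) = M \<inter> N"
      using y by blast+
    moreover have "fst ` insert (u, y) M = insert u (fst ` M)" "snd ` insert (u, y) M = insert y (snd ` M)"
      by simp_all
    ultimately show ?thesis
      using yN False rmN by metis
  next
    case True
    then obtain x where x: "(x, y) \<in> M"
      by auto
    have xM: "x \<in> fst ` M"
      using x by force
    have xu: "x \<noteq> u"
      using xM less.prems(7) by metis
    have xyN: "(x, y) \<notin> N" and uyM: "(u, y) \<notin> M"
      using xu x y inj_onD[OF less.prems(5), of "(x, y)" "(u, y)"] inj_onD[OF less.prems(3), of "(x, y)" "(u, y)"]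
      by auto
    have rmM: "fst ` (M - {(x, y)}) = fst ` M - {x}" "snd ` (M - {(x, y)}) = snd ` M - {y}"
      using inj_image_remove[of fst M "(x, y)"] inj_image_remove[of snd M "(x, y)"] less.prems x by auto
    show ?thesis
    proof (cases "x \<in> fst ` N")
      \<comment> \<open>The path stops at \<open>x\<close> after two edges, which trade places
        between the matchings.\<close>
      case False
      have "inj_on fst (M - {(x, y)})" "inj_on snd (M - {(x, y)})"
        "inj_on fst (N - {(u, y)})" "inj_on snd (N - {(u, y)})"
        using less.prems by (auto intro: inj_on_subset)
      then have "inj_on fst (insert (u, y) (M - {(x, y)}))" "inj_on snd (insert (u, y) (M - {(x, y)}))"
        "inj_on fst (insert (x, y) (N - {(u, y)}))" "inj_on snd (insert (x, y) (N - {(u, y)}))"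
        using less.prems(7) False
        by (simp_all add: inj_on_fst_insert inj_on_snd_insert rmM rmN del: inj_on_insert)
      moreover have "insert (u, y) (M - {(x, y)}) \<union> insert (x, y) (N - {(u, y)}) = M \<union> N"
        "insert (u, y) (M - {(x, y)}) \<inter> insert (x, y) (N - {(u, y)}) = M \<inter> N"
        using x y xu xyN uyM by auto
      moreover have "insert u (S - {x}) = insert u S - {x}" "insert x (S - {u}) = insert x S - {u}" for S
        using xu by auto
      then have "fst ` insert (u, y) (M - {(x, y)}) = insert u (fst ` M) - {x}"
        "snd ` insert (u, y) (M - {(x, y)}) = snd ` M"
        "fst ` insert (x, y) (N - {(u, y)}) = insert x (fst ` N) - {u}"
        "snd ` insert (x, y) (N - {(u, y)}) = snd ` N"
        using True yN by (simp_all add: rmM rmN insert_absorb)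
      ultimately show ?thesis
        using xM False by metis
    next
      case xN: True
      \<comment> \<open>Cut off the first two edges and continue from \<open>x\<close>, which is now
        the free source. Afterwards both edges return on the opposite sides, \<open>(u, y)\<close>
        with \<open>M'\<close> and \<open>(x, y)\<close> with \<open>N'\<close>.\<close>
      define M0 where "M0 = M - {(x, y)}"
      define N0 where "N0 = N - {(u, y)}"
      have prems: "finite M0" "inj_on fst M0" "inj_on snd M0" "inj_on fst N0" "inj_on snd N0"
        using less.prems by (auto simp: M0_def N0_def intro: inj_on_subset)
      have less': "card M0 < card M"
        unfolding M0_def using less.prems(1) x by (rule card_Diff1_less)
      have x0: "x \<in> fst ` N0" "x \<notin> fst ` M0"
        using xN xu by (simp_all add: M0_def N0_def rmM rmN)
      obtain M' N' where
        un: "M' \<union> N' = M0 \<union> N0" and int: "M' \<inter> N' = M0 \<inter> N0" and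
        inj: "inj_on fst M'" "inj_on snd M'" "inj_on fst N'" "inj_on snd N'" and
        alt: "(\<exists>v. v \<in> snd ` N0 \<and> v \<notin> snd ` M0 \<and> fst ` M' = insert x (fst ` M0) \<and>
            snd ` M' = insert v (snd ` M0) \<and> fst ` N' = fst ` N0 - {x} \<and> snd ` N' = snd ` N0 - {v}) \<or>
          (\<exists>b. b \<in> fst ` M0 \<and> b \<notin> fst ` N0 \<and> fst ` M' = insert x (fst ` M0) - {b} \<and>
            snd ` M' = snd ` M0 \<and> fst ` N' = insert b (fst ` N0) - {x} \<and> snd ` N' = snd ` N0)"
        using less.hyps[OF less' prems x0] by (elim exE conjE) (rule that)
      have un': "insert (u, y) M' \<union> insert (x, y) N' = M \<union> N"
        using un x y by (auto simp: M0_def N0_def)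
      have int': "insert (u, y) M' \<inter> insert (x, y) N' = M \<inter> N"
        using un int x y xu xyN uyM unfolding M0_def N0_def by blast
      have eqs: "fst ` M0 = fst ` M - {x}" "snd ` M0 = snd ` M - {y}"
        "fst ` N0 = fst ` N - {u}" "snd ` N0 = snd ` N - {y}"
        by (simp_all add: M0_def N0_def rmM rmN)
      from alt show ?thesis
      proof (elim disjE exE conjE)
        fix v
        assume v: "v \<in> snd ` N0" "v \<notin> snd ` M0" "fst ` M' = insert x (fst ` M0)"
          "snd ` M' = insert v (snd ` M0)" "fst ` N' = fst ` N0 - {x}" "snd ` N' = snd ` N0 - {v}"
        have "y \<noteq> v"
          using v(1) by (auto simp: eqs)
        then have ins: "insert y (S - {y} - {v}) = S - {v}" if "y \<in> S" for S
          using that by auto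
        from \<open>y \<noteq> v\<close> have "inj_on fst (insert (u, y) M')" "inj_on snd (insert (u, y) M')"
          "inj_on fst (insert (x, y) N')" "inj_on snd (insert (x, y) N')"
          using inj v less.prems(7) xu
          by (simp_all add: inj_on_fst_insert inj_on_snd_insert eqs del: inj_on_insert)
        moreover have "fst ` insert (u, y) M' = insert u (fst ` M)" "snd ` insert (u, y) M' = insert v (snd ` M)"
          "fst ` insert (x, y) N' = fst ` N - {u}" "snd ` insert (x, y) N' = snd ` N - {v}"
          using v xM True yN xN xu by (simp_all add: eqs ins insert_absorb insert_commute insert_Diff_if)
        moreover have "v \<in> snd ` N" "v \<notin> snd ` M"
          using v by (auto simp: eqs)
        ultimately show ?thesis
          using un' int' by (intro exI[of _ "insert (u, y) M'"] exI[of _ "insert (x, y) N'"] conjI disjI1 exI[of _ v])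
      next
        fix b
        assume b: "b \<in> fst ` M0" "b \<notin> fst ` N0" "fst ` M' = insert x (fst ` M0) - {b}"
          "snd ` M' = snd ` M0" "fst ` N' = insert b (fst ` N0) - {x}" "snd ` N' = snd ` N0"
        have "inj_on fst (insert (u, y) M')" "inj_on snd (insert (u, y) M')"
          "inj_on fst (insert (x, y) N')" "inj_on snd (insert (x, y) N')"
          using inj b less.prems(7) xu
          by (simp_all add: inj_on_fst_insert inj_on_snd_insert eqs del: inj_on_insert)
        moreover have "b \<in> fst ` M" "b \<notin> fst ` N" "b \<noteq> u" "b \<noteq> x"
          using b less.prems(7) by (auto simp: eqs)
        moreover from this have "fst ` insert (u, y) M' = insert u (fst ` M) - {b}" "snd ` insert (u, y) M' = snd ` M"
          "fst ` insert (x, y) N' = insert b (fst ` N) - {u}" "snd ` insert (x, y) N' = snd ` N"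
          using b xM True yN xN xu by (simp_all add: eqs insert_absorb insert_commute insert_Diff_if)
        ultimately show ?thesis
          using un' int' by (intro exI[of _ "insert (u, y) M'"] exI[of _ "insert (x, y) N'"] conjI disjI2 exI[of _ b])
      qed
    qed
  qed
qed

section \<open>Optimal matchings of consecutive sizes\<close>

lemma is_matching_subset: "is_matching X Y M \<Longrightarrow> N \<subseteq> M \<Longrightarrow> is_matching X Y N"
  by (auto simp: is_matching_def intro: inj_on_subset)

lemma finite_matching: "finite X \<Longrightarrow> finite Y \<Longrightarrow> is_matching X Y M \<Longrightarrow> finite M"
  by (auto simp: is_matching_def intro: finite_subset)

lemma is_matching_fst: "is_matching X Y M \<Longrightarrow> fst ` M \<subseteq> X"
  and is_matching_snd: "is_matching X Y M \<Longrightarrow> snd ` M \<subseteq> Y"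
  and card_fst_matching: "is_matching X Y M \<Longrightarrow> card (fst ` M) = card M"
  and card_snd_matching: "is_matching X Y M \<Longrightarrow> card (snd ` M) = card M"
  by (auto simp: is_matching_def card_image)

text \<open>An optimal matching of \<open>Suc k\<close> pairs is chosen to share as many sources
  with \<open>M\<close> as possible, and an alternating path is followed from one of its sources
  outside \<open>M\<close>. The exchange preserves the sum of the two costs. An augmenting path
  therefore leaves both new matchings optimal; an even path would give an optimal matching that
  shares one more source with \<open>M\<close>.\<close>

lemma optimal_matching_extends:
  fixes c :: "real \<times> real \<Rightarrow> real"
  assumes fin: "finite X" "finite Y"
    and M: "is_matching X Y M" "card M = k"
    and optM: "\<And>M'. is_matching X Y M' \<Longrightarrow> card M' = k \<Longrightarrow> sum c M \<le> sum c M'"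
    and N: "is_matching X Y N" "card N = Suc k"
    and optN: "\<And>N'. is_matching X Y N' \<Longrightarrow> card N' = Suc k \<Longrightarrow> sum c N \<le> sum c N'"
  obtains M' u v where "is_matching X Y M'" "card M' = Suc k" "sum c M' = sum c N"
    "u \<in> X - fst ` M" "v \<in> Y - snd ` M" "fst ` M' = insert u (fst ` M)" "snd ` M' = insert v (snd ` M)"
proof -
  define P where "P N' \<longleftrightarrow> is_matching X Y N' \<and> card N' = Suc k \<and> sum c N' = sum c N" for N'
  have "\<exists>N1. P N1 \<and> (\<forall>N2. P N2 \<longrightarrow> card (fst ` N2 \<inter> fst ` M) \<le> card (fst ` N1 \<inter> fst ` M))"
    using N finite_matching[OF fin M(1)]
    by (intro ex_has_greatest_nat[of P N _ "Suc (card (fst ` M))"])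
       (auto simp: P_def less_Suc_eq_le intro!: card_mono)
  then obtain N1 where N1: "P N1"
    and max: "\<And>N2. P N2 \<Longrightarrow> card (fst ` N2 \<inter> fst ` M) \<le> card (fst ` N1 \<inter> fst ` M)"
    by blast
  have N1': "is_matching X Y N1" "card N1 = Suc k" "sum c N1 = sum c N"
    using N1 by (auto simp: P_def)
  have finM: "finite M" "finite N1"
    using finite_matching[OF fin] M N1' by auto
  have "\<not> fst ` N1 \<subseteq> fst ` M"
    using card_mono[of "fst ` M" "fst ` N1"] finM card_fst_matching[OF M(1)] card_fst_matching[OF N1'(1)] M N1'
    by auto
  then obtain u where u: "u \<in> fst ` N1" "u \<notin> fst ` M"
    by blast
  have inj: "inj_on fst M" "inj_on snd M" "inj_on fst N1" "inj_on snd N1"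
    using M N1' by (auto simp: is_matching_def)
  obtain M' N' where un: "M' \<union> N' = M \<union> N1" and int: "M' \<inter> N' = M \<inter> N1"
    and inj': "inj_on fst M'" "inj_on snd M'" "inj_on fst N'" "inj_on snd N'"
    and alt: "(\<exists>v. v \<in> snd ` N1 \<and> v \<notin> snd ` M \<and> fst ` M' = insert u (fst ` M) \<and> snd ` M' = insert v (snd ` M) \<and>
          fst ` N' = fst ` N1 - {u} \<and> snd ` N' = snd ` N1 - {v}) \<or>
       (\<exists>b. b \<in> fst ` M \<and> b \<notin> fst ` N1 \<and> fst ` M' = insert u (fst ` M) - {b} \<and> snd ` M' = snd ` M \<and>
          fst ` N' = insert b (fst ` N1) - {u} \<and> snd ` N' = snd ` N1)"
    using alternating_path_exchange[OF finM(1) inj u] by (elim exE conjE) (rule that)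
  have "M' \<union> N' \<subseteq> X \<times> Y"
    using un M N1' by (auto simp: is_matching_def)
  then have mat: "is_matching X Y M'" "is_matching X Y N'"
    using inj' by (auto simp: is_matching_def)
  have "finite (M' \<union> N')"
    using un finM by simp
  then have sums: "sum c M' + sum c N' = sum c M + sum c N1"
    using sum.union_inter[of M' N' c] sum.union_inter[of M N1 c] un int finM by (metis finite_Un)
  note cards = card_fst_matching[OF mat(1)] card_fst_matching[OF mat(2)]
    card_snd_matching[OF mat(1)] card_snd_matching[OF mat(2)]
    card_fst_matching[OF M(1)] card_fst_matching[OF N1'(1)]
    card_snd_matching[OF M(1)] card_snd_matching[OF N1'(1)]
  from alt show thesis
  proof (elim disjE exE conjE)
    fix v
    assume v: "v \<in> snd ` N1" "v \<notin> snd ` M" "fst ` M' = insert u (fst ` M)" "snd ` M' = insert v (snd ` M)"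
      "fst ` N' = fst ` N1 - {u}" "snd ` N' = snd ` N1 - {v}"
    have "card M' = Suc k" "card N' = k"
      using cards v u finM M N1' by auto
    then have "sum c M' = sum c N"
      using optM[of N'] optN[of M'] mat sums N1' by simp
    moreover have "u \<in> X" "v \<in> Y"
      using u v is_matching_fst[OF N1'(1)] is_matching_snd[OF N1'(1)] by auto
    ultimately show thesis
      using that[of M' u v] v u mat \<open>card M' = Suc k\<close> by blast
  next
    fix b
    assume b: "b \<in> fst ` M" "b \<notin> fst ` N1" "fst ` M' = insert u (fst ` M) - {b}" "snd ` M' = snd ` M"
      "fst ` N' = insert b (fst ` N1) - {u}" "snd ` N' = snd ` N1"
    have "card M' = k" "card N' = Suc k"
      using cards b M N1' by simp_all
    then have "P N'"
      using optM[of M'] optN[of N'] mat sums N1' by (simp add: P_def)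
    moreover have "(insert b S - {u}) \<inter> T = insert b (S \<inter> T)" if "b \<in> T" "u \<notin> T" for S T
      using that by blast
    then have "fst ` N' \<inter> fst ` M = insert b (fst ` N1 \<inter> fst ` M)"
      using b(1,5) u(2) by simp
    ultimately show thesis
      using max[of N'] b finM by simp
  qed
qed

section \<open>The flow of an optimal matching\<close>

declare sum_of_bool_eq [simp del]

text \<open>Passes from coordinates to positions relative to \<open>u\<close>. One correction
  depends only on \<open>p\<close>, the other only on \<open>t\<close>, so a difference over equally
  many sources and targets changes by a constant.\<close>

lemma of_bool_cw_dist:
  assumes "u \<in> {0..<L}" "p \<in> {0..<L}" "t \<in> {0..<L}"
  shows "(of_bool (cw_dist L u p \<le> cw_dist L u t) :: real) = of_bool (p \<le> t) - of_bool (p < u) + of_bool (t < u)"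
  using assms by (auto simp: cw_dist_def)

lemma circ_dist_le_cw_dist:
  assumes "u \<in> {0..<L}" "p \<in> {0..<L}" "q \<in> {0..<L}"
  shows "circ_dist L p q \<le> \<bar>cw_dist L u p - cw_dist L u q\<bar>"
  using assms by (auto simp: cw_dist_def circ_dist_def)

lemma circ_dist_le_cw_dist_end:
  assumes "u \<in> {0..<L}" "p \<in> {0..<L}"
  shows "circ_dist L p u \<le> \<bar>cw_dist L u p - L\<bar>" "circ_dist L u p \<le> \<bar>L - cw_dist L u p\<bar>"
  using assms by (auto simp: cw_dist_def circ_dist_def)

lemma cw_dist_inj: "u \<in> {0..<L} \<Longrightarrow> inj_on (cw_dist L u) {0..<L}"
  by (auto simp: inj_on_def cw_dist_def split: if_splits)

lemma cw_dist_self [simp]: "cw_dist L u u = 0"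
  by (simp add: cw_dist_def)

lemma cw_dist_pos: "u \<in> {0..<L} \<Longrightarrow> p \<in> {0..<L} \<Longrightarrow> p \<noteq> u \<Longrightarrow> 0 < cw_dist L u p"
  by (auto simp: cw_dist_def)

text \<open>Pairs \<open>P\<close> and \<open>Q\<close> in the order of their positions; by
  \<open>le\<close> this costs no more on the circle than on the line. The map \<open>pos\<close> is
  left open since \<open>swap_target\<close> needs the base point at \<open>L\<close> instead of
  0.\<close>

lemma obtain_sorted_matching:
  assumes u: "u \<in> {0..<L}" and fin: "finite P" "finite Q" "card P = card Q"
    and PQ: "P \<subseteq> X" "Q \<subseteq> Y" and inj: "inj_on pos P" "inj_on pos Q"
    and pos: "pos ` P \<subseteq> {0..L}" "pos ` Q \<subseteq> {0..L}"
    and le: "\<And>p q. p \<in> P \<Longrightarrow> q \<in> Q \<Longrightarrow> circ_dist L p q \<le> \<bar>pos p - pos q\<bar>"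
  obtains M where "is_matching X Y M" "card M = card P" "active_set M = P \<union> Q"
    "(\<Sum>(x, y)\<in>M. circ_dist L x y) \<le>
      (\<integral>t. \<bar>(\<Sum>p\<in>P. of_bool (pos p \<le> cw_dist L u t)) - (\<Sum>q\<in>Q. of_bool (pos q \<le> cw_dist L u t))\<bar> \<partial>circle L)"
proof -
  define xs ys where "xs = sorted_list_of_set (pos ` P)" and "ys = sorted_list_of_set (pos ` Q)"
  define p q where "p i = inv_into P pos (xs ! i)" and "q i = inv_into Q pos (ys ! i)" for i
  have card: "card (pos ` P) = card P" "card (pos ` Q) = card P"
    using inj fin by (simp_all add: card_image)
  have bp: "bij_betw p {..<card P} P"
  proof -
    have "bij_betw (\<lambda>i. xs ! i) {..<card P} (pos ` P)"
      unfolding xs_def using fin card by (intro bij_betw_nth) auto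
    then show ?thesis
      unfolding p_def using bij_betw_trans[OF _ bij_betw_inv_into[OF inj_on_imp_bij_betw[OF inj(1)]]]
      by (auto simp: comp_def)
  qed
  have bq: "bij_betw q {..<card P} Q"
  proof -
    have "bij_betw (\<lambda>i. ys ! i) {..<card P} (pos ` Q)"
      unfolding ys_def using fin card by (intro bij_betw_nth) auto
    then show ?thesis
      unfolding q_def using bij_betw_trans[OF _ bij_betw_inv_into[OF inj_on_imp_bij_betw[OF inj(2)]]]
      by (auto simp: comp_def)
  qed
  have pos_p: "pos (p i) = xs ! i" and pos_q: "pos (q i) = ys ! i" if "i < card P" for i
  proof -
    have "xs ! i \<in> pos ` P" "ys ! i \<in> pos ` Q"
      using that card fin nth_mem[of i xs] nth_mem[of i ys] by (auto simp: xs_def ys_def)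
    then show "pos (p i) = xs ! i" "pos (q i) = ys ! i"
      by (simp_all add: p_def q_def f_inv_into_f)
  qed
  define M where "M = (\<lambda>i. (p i, q i)) ` {..<card P}"
  have inj_pq: "inj_on (\<lambda>i. (p i, q i)) {..<card P}"
    using bp by (auto simp: bij_betw_def inj_on_def)
  have fstM: "fst ` M = P" and sndM: "snd ` M = Q"
    using bp bq by (auto simp: M_def image_image bij_betw_def)
  have cardM: "card M = card P"
    using inj_pq by (simp add: M_def card_image)
  have "inj_on fst M" "inj_on snd M"
    using bp bq by (auto simp: M_def bij_betw_def inj_on_def)
  then have "is_matching X Y M"
    using fstM sndM PQ by (auto simp: is_matching_def)
  moreover have "(\<Sum>(x, y)\<in>M. circ_dist L x y) = (\<Sum>i<card P. circ_dist L (p i) (q i))"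
    unfolding M_def by (subst sum.reindex[OF inj_pq]) simp
  moreover have "\<dots> \<le> (\<Sum>i<card P. \<bar>xs ! i - ys ! i\<bar>)"
    using le bp bq by (intro sum_mono) (auto simp flip: pos_p pos_q simp: bij_betw_def)
  moreover have "\<dots> = line_cost 1 (pos ` P) (pos ` Q)"
    by (simp add: line_cost_def card xs_def ys_def)
  moreover have "\<dots> = (\<integral>t. \<bar>(\<Sum>p\<in>P. of_bool (pos p \<le> cw_dist L u t)) -
      (\<Sum>q\<in>Q. of_bool (pos q \<le> cw_dist L u t))\<bar> \<partial>circle L)"
    using fin pos card by (subst line_cost_eq_integral[OF u]) (simp_all add: sum.reindex inj)
  ultimately show thesis
    using that[of M] cardM fstM sndM by (simp add: active_set_def)
qed

text \<open>The right derivative of the absolute value at \<open>F t\<close>: the price of sending a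
  little more flow clockwise through \<open>t\<close>.\<close>

definition slope :: "(real \<Rightarrow> real) \<Rightarrow> real \<Rightarrow> real" where
  "slope F t = (if F t \<ge> 0 then 1 else - 1)"

text \<open>Convexity of the absolute value: the right tangent lies below the graph.\<close>

lemma abs_add_ge_slope: "e \<ge> 0 \<Longrightarrow> \<bar>F t\<bar> + slope F t * e \<le> \<bar>F t + e\<bar>"
  by (auto simp: slope_def)

text \<open>An integer flow cannot jump across 0 when it grows by one unit, so the tangent estimate
  is exact.\<close>

lemma abs_add_of_bool_eq_slope:
  assumes "F t \<in> \<int>"
  shows "\<bar>F t + of_bool b\<bar> = \<bar>F t\<bar> + slope F t * of_bool b"
proof -
  obtain i where i: "F t = of_int i"
    using assms by (auto elim: Ints_cases)
  then show ?thesis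
    by (cases "i \<ge> 0") (auto simp: slope_def)
qed

text \<open>F is the clockwise flow of an optimal matching with active set A; it vanishes at the
  inactive atoms, hence the unrolling of A at any inactive atom describes F.\<close>

locale optimal_flow =
  fixes L :: real and X Y A :: "real set" and k :: nat and F :: "real \<Rightarrow> real"
  assumes fin: "finite X" "finite Y"
    and range: "X \<subseteq> {0..<L}" "Y \<subseteq> {0..<L}"
    and disj: "X \<inter> Y = {}"
    and active: "A \<subseteq> X \<union> Y"
    and cardA: "card (A \<inter> X) = k" "card (A \<inter> Y) = k"
    and flow_eq: "\<And>u t. u \<in> X \<union> Y - A \<Longrightarrow> t \<in> {0..<L} \<Longrightarrow> F t =
      (\<Sum>x\<in>A \<inter> X. of_bool (cw_dist L u x \<le> cw_dist L u t)) -
      (\<Sum>y\<in>A \<inter> Y. of_bool (cw_dist L u y \<le> cw_dist L u t))"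
    and step: "simple_function (circle L) F"
    and flow_le: "\<And>M. is_matching X Y M \<Longrightarrow> card M = k \<Longrightarrow>
      (\<integral>t. \<bar>F t\<bar> \<partial>circle L) \<le> (\<Sum>(x, y)\<in>M. circ_dist L x y)"
begin

lemma flow_Ints: "u \<in> X \<union> Y - A \<Longrightarrow> t \<in> {0..<L} \<Longrightarrow> F t \<in> \<int>"
  by (simp only: flow_eq[of u]) (intro Ints_diff Ints_sum, auto)

lemma integrable_abs_flow [simp]: "integrable (circle L) (\<lambda>t. \<bar>F t\<bar>)"
  by (intro integrable_abs integrable_step step)

lemma step_slope: "simple_function (circle L) (slope F)"
  using simple_function_compose1[OF step, of "\<lambda>a. if a \<ge> 0 then 1 else - 1 :: real"]
  by (simp add: slope_def[abs_def])

lemma integrable_slope [simp]: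
  "Measurable.pred (circle L) P \<Longrightarrow> integrable (circle L) (\<lambda>t. slope F t * of_bool (P t))"
  by (intro integrable_step simple_function_mult step_slope step_of_bool)

lemma pred_less [simp, measurable]: "Measurable.pred (circle L) (\<lambda>t. cw_dist L u t < l)"
  and pred_ge [simp, measurable]: "Measurable.pred (circle L) (\<lambda>t. l \<le> cw_dist L u t)"
  by measurable

lemma integral_abs_add_of_bool:
  assumes "u \<in> X \<union> Y - A" "Measurable.pred (circle L) P"
  shows "(\<integral>t. \<bar>F t + of_bool (P t)\<bar> \<partial>circle L)
       = (\<integral>t. \<bar>F t\<bar> \<partial>circle L) + (\<integral>t. slope F t * of_bool (P t) \<partial>circle L)"
proof -
  have "(\<integral>t. \<bar>F t + of_bool (P t)\<bar> \<partial>circle L) = (\<integral>t. \<bar>F t\<bar> + slope F t * of_bool (P t) \<partial>circle L)"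
    using abs_add_of_bool_eq_slope[of F] flow_Ints[OF assms(1)]
    by (intro Bochner_Integration.integral_cong) auto
  then show ?thesis
    using assms by simp
qed

text \<open>Counted from \<open>p\<close>, the flow at \<open>p\<close> is 0, as no active atom has
  position 0. Counted from \<open>u\<close>, the same value is the excess of active sources over
  active targets on the arc from \<open>u\<close> to \<open>p\<close>.\<close>

lemma inactive_balanced:
  assumes "u \<in> X \<union> Y - A" "p \<in> X \<union> Y - A"
  shows "(\<Sum>x\<in>A \<inter> X. of_bool (cw_dist L u x < cw_dist L u p) :: real)
       = (\<Sum>y\<in>A \<inter> Y. of_bool (cw_dist L u y < cw_dist L u p))"
proof -
  have p: "p \<in> {0..<L}" and u: "u \<in> {0..<L}"
    using assms range by auto
  have "\<not> cw_dist L p a \<le> cw_dist L p p" if "a \<in> A" for a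
  proof -
    have "a \<in> {0..<L}" "a \<noteq> p"
      using that assms active range by blast+
    then show ?thesis
      using cw_dist_pos[OF p, of a] by simp
  qed
  then have "F p = 0"
    using flow_eq[OF assms(2) p] by simp
  moreover have "cw_dist L u a \<le> cw_dist L u p \<longleftrightarrow> cw_dist L u a < cw_dist L u p" if "a \<in> A" for a
  proof -
    have "a \<in> {0..<L}" "a \<noteq> p"
      using that assms active range by blast+
    then show ?thesis
      using inj_onD[OF cw_dist_inj[OF u], of a p] p by fastforce
  qed
  then have "(\<Sum>a\<in>A \<inter> B. of_bool (cw_dist L u a \<le> cw_dist L u p) :: real) =
      (\<Sum>a\<in>A \<inter> B. of_bool (cw_dist L u a < cw_dist L u p))" for B
    by (intro sum.cong) simp_all
  ultimately show ?thesis
    using flow_eq[OF assms(1) p] by simp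
qed

text \<open>Replacing the source \<open>b\<close> by \<open>u\<close> adds one unit to
  \<open>F\<close> on the arc from \<open>u\<close> to \<open>b\<close>. The result is realized by a
  matching of \<open>k\<close> pairs, so optimality of \<open>F\<close> forbids a gain.\<close>

lemma swap_source:
  assumes u: "u \<in> X - A" and b: "b \<in> A \<inter> X"
  shows "0 \<le> (\<integral>t. slope F t * of_bool (cw_dist L u t < cw_dist L u b) \<partial>circle L)"
proof -
  have uL: "u \<in> {0..<L}" and sub: "A \<inter> X \<subseteq> {0..<L}" "A \<inter> Y \<subseteq> {0..<L}"
    using u range by auto
  let ?P = "insert u (A \<inter> X - {b})"
  have finA: "finite (A \<inter> X)" "finite (A \<inter> Y)"
    using fin by auto
  have P: "?P \<subseteq> {0..<L}"
    using sub uL by auto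
  have "card ?P = k"
    unfolding cardA(1)[symmetric] card.remove[OF finA(1) b] using u finA by (intro card_insert_disjoint) auto
  note P = P this
  have cwr: "cw_dist L u p \<in> {0..L}" if "p \<in> {0..<L}" for p
    using cw_dist_range[OF uL that] by simp
  obtain M where M: "is_matching X Y M" "card M = card ?P"
    "(\<Sum>(x, y)\<in>M. circ_dist L x y) \<le> (\<integral>t. \<bar>(\<Sum>p\<in>?P. of_bool (cw_dist L u p \<le> cw_dist L u t)) -
        (\<Sum>q\<in>A \<inter> Y. of_bool (cw_dist L u q \<le> cw_dist L u t))\<bar> \<partial>circle L)"
  proof (rule obtain_sorted_matching[OF uL, of ?P "A \<inter> Y" X Y "cw_dist L u"])
    show "cw_dist L u ` ?P \<subseteq> {0..L}" "cw_dist L u ` (A \<inter> Y) \<subseteq> {0..L}"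
      using cwr P(1) sub by blast+
    show "inj_on (cw_dist L u) ?P" "inj_on (cw_dist L u) (A \<inter> Y)"
      using inj_on_subset[OF cw_dist_inj[OF uL]] P(1) sub by blast+
    show "circ_dist L p q \<le> \<bar>cw_dist L u p - cw_dist L u q\<bar>" if "p \<in> ?P" "q \<in> A \<inter> Y" for p q
      using that P(1) sub by (intro circ_dist_le_cw_dist uL) auto
  qed (use u P finA cardA in auto)
  have "(\<Sum>p\<in>?P. of_bool (cw_dist L u p \<le> cw_dist L u t)) - (\<Sum>q\<in>A \<inter> Y. of_bool (cw_dist L u q \<le> cw_dist L u t))
      = F t + of_bool (cw_dist L u t < cw_dist L u b)" if t: "t \<in> {0..<L}" for t
    using u b finA flow_eq[of u t] t cw_dist_range[OF uL t] by (simp add: sum_diff1)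
  then have "(\<Sum>(x, y)\<in>M. circ_dist L x y) \<le>
      (\<integral>t. \<bar>F t + of_bool (cw_dist L u t < cw_dist L u b)\<bar> \<partial>circle L)"
    by (intro order_trans[OF M(3)] eq_refl Bochner_Integration.integral_cong refl arg_cong[where f = abs]) simp_all
  then show ?thesis
    using flow_le[OF M(1)] M(2) P(2) u by (simp add: integral_abs_add_of_bool[of u])
qed

text \<open>Replacing the target \<open>a\<close> by \<open>v\<close> adds one unit to
  \<open>F\<close> on the arc from \<open>a\<close> to \<open>v\<close>.\<close>

lemma swap_target:
  assumes v: "v \<in> Y - A" and a: "a \<in> A \<inter> Y"
  shows "0 \<le> (\<integral>t. slope F t * of_bool (cw_dist L v a \<le> cw_dist L v t) \<partial>circle L)"
proof -
  have vL: "v \<in> {0..<L}" and sub: "A \<inter> X \<subseteq> {0..<L}" "A \<inter> Y \<subseteq> {0..<L}"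
    using v range by auto
  have vA: "v \<notin> A"
    using v by simp
  let ?Q = "insert v (A \<inter> Y - {a})"
  \<comment> \<open>The new target closes the arc that starts at \<open>a\<close>, so it is placed
    at \<open>L\<close> and not at 0, although \<open>v\<close> is the base point.\<close>
  define pos where "pos p = (if p = v then L else cw_dist L v p)" for p
  have finA: "finite (A \<inter> X)" "finite (A \<inter> Y)"
    using fin by auto
  have Q: "?Q \<subseteq> {0..<L}"
    using sub vL by auto
  have "card ?Q = k"
    unfolding cardA(2)[symmetric] card.remove[OF finA(2) a] using v finA by (intro card_insert_disjoint) auto
  note Q = Q this
  have posr: "pos p \<in> {0..L}" if "p \<in> {0..<L}" for p
    using cw_dist_range[OF vL that] vL by (auto simp: pos_def)
  have posi: "inj_on pos {0..<L}"
  proof (rule inj_onI)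
    fix p q assume pq: "p \<in> {0..<L}" "q \<in> {0..<L}" "pos p = pos q"
    then show "p = q"
      using cw_dist_range[OF vL pq(1)] cw_dist_range[OF vL pq(2)] inj_onD[OF cw_dist_inj[OF vL] _ pq(1,2)]
      by (simp add: pos_def split: if_splits)
  qed
  obtain M where M: "is_matching X Y M" "card M = card (A \<inter> X)"
    "(\<Sum>(x, y)\<in>M. circ_dist L x y) \<le> (\<integral>t. \<bar>(\<Sum>p\<in>A \<inter> X. of_bool (pos p \<le> cw_dist L v t)) -
        (\<Sum>q\<in>?Q. of_bool (pos q \<le> cw_dist L v t))\<bar> \<partial>circle L)"
  proof (rule obtain_sorted_matching[OF vL, of "A \<inter> X" ?Q X Y pos])
    show "pos ` (A \<inter> X) \<subseteq> {0..L}" "pos ` ?Q \<subseteq> {0..L}"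
      using posr Q(1) sub by blast+
    show "inj_on pos (A \<inter> X)" "inj_on pos ?Q"
      using inj_on_subset[OF posi] Q(1) sub by blast+
    show "circ_dist L p q \<le> \<bar>pos p - pos q\<bar>" if pq: "p \<in> A \<inter> X" "q \<in> ?Q" for p q
    proof -
      have "p \<in> {0..<L}" "q \<in> {0..<L}" "p \<noteq> v"
        using pq Q(1) sub vA by blast+
      then show ?thesis
        using circ_dist_le_cw_dist[OF vL, of p q] circ_dist_le_cw_dist_end[OF vL, of p] by (simp add: pos_def)
    qed
  qed (use v Q finA cardA in auto)
  have "(\<Sum>p\<in>A \<inter> X. of_bool (pos p \<le> cw_dist L v t)) - (\<Sum>q\<in>?Q. of_bool (pos q \<le> cw_dist L v t))
      = F t + of_bool (cw_dist L v a \<le> cw_dist L v t)" if t: "t \<in> {0..<L}" for t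
  proof -
    have "pos p = cw_dist L v p" if "p \<in> A" for p
      using that vA by (auto simp: pos_def)
    moreover have "\<not> pos v \<le> cw_dist L v t"
      using cw_dist_range[OF vL t] by (simp add: pos_def)
    ultimately show ?thesis
      using v a finA flow_eq[of v t] t by (simp add: sum_diff1)
  qed
  then have "(\<Sum>(x, y)\<in>M. circ_dist L x y) \<le>
      (\<integral>t. \<bar>F t + of_bool (cw_dist L v a \<le> cw_dist L v t)\<bar> \<partial>circle L)"
    by (intro order_trans[OF M(3)] eq_refl Bochner_Integration.integral_cong refl arg_cong[where f = abs]) simp_all
  then show ?thesis
    using flow_le[OF M(1)] M(2) cardA v by (simp add: integral_abs_add_of_bool[of v])
qed

text \<open>Behind the last active source b of the arc the flow is nonincreasing, hence nonnegative, and
  the part up to b is a swap of b for u.\<close>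

lemma source_arc:
  assumes u: "u \<in> X - A" and l: "0 \<le> l"
    and bal: "(\<Sum>x\<in>A \<inter> X. of_bool (cw_dist L u x < l) :: real) = (\<Sum>y\<in>A \<inter> Y. of_bool (cw_dist L u y < l))"
  shows "0 \<le> (\<integral>t. slope F t * of_bool (cw_dist L u t < l) \<partial>circle L)"
proof -
  have uL: "u \<in> {0..<L}"
    using u range by auto
  \<comment> \<open>The default 0 stands for an arc without active sources; the arc up to it is
    empty.\<close>
  define R where "R = insert 0 {z \<in> cw_dist L u ` (A \<inter> X). z < l}"
  have "finite R"
    using fin by (simp add: R_def)
  define z where "z = Max R"
  have z: "z \<in> R" and zmax: "\<And>y. y \<in> R \<Longrightarrow> y \<le> z"
    using \<open>finite R\<close> unfolding z_def by (intro Max_in, auto simp: R_def)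
  have zl: "z \<le> l"
    using z l by (auto simp: R_def)
  have "0 \<le> (\<integral>t. slope F t * of_bool (cw_dist L u t < z) \<partial>circle L)"
  proof (cases "\<exists>b\<in>A \<inter> X. z = cw_dist L u b")
    case True
    then show ?thesis
      using swap_source[OF u] by auto
  next
    case False
    then have "z = 0"
      using z by (auto simp: R_def)
    then have "(\<integral>t. slope F t * of_bool (cw_dist L u t < z) \<partial>circle L) = (\<integral>t. (0 :: real) \<partial>circle L)"
    proof (intro Bochner_Integration.integral_cong refl)
      fix t assume "t \<in> space (circle L)"
      then show "slope F t * of_bool (cw_dist L u t < z) = 0"
        using cw_dist_range[OF uL, of t] \<open>z = 0\<close> by simp
    qed
    then show ?thesis
      by simp
  qed
  also have "\<dots> \<le> (\<integral>t. slope F t * of_bool (cw_dist L u t < l) \<partial>circle L)"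
  proof (rule integral_mono)
    fix t assume "t \<in> space (circle L)"
    then have t: "t \<in> {0..<L}"
      by simp
    show "slope F t * of_bool (cw_dist L u t < z) \<le> slope F t * of_bool (cw_dist L u t < l)"
    proof (cases "z \<le> cw_dist L u t \<and> cw_dist L u t < l")
      case True
      have "(\<Sum>x\<in>A \<inter> X. of_bool (cw_dist L u x < l) :: real) \<le> (\<Sum>x\<in>A \<inter> X. of_bool (cw_dist L u x \<le> cw_dist L u t))"
      proof (rule sum_mono)
        fix x assume "x \<in> A \<inter> X"
        then have "cw_dist L u x < l \<Longrightarrow> cw_dist L u x \<le> cw_dist L u t"
          using zmax[of "cw_dist L u x"] True by (simp add: R_def)
        then show "(of_bool (cw_dist L u x < l) :: real) \<le> of_bool (cw_dist L u x \<le> cw_dist L u t)"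
          by simp
      qed
      moreover have "(\<Sum>y\<in>A \<inter> Y. of_bool (cw_dist L u y \<le> cw_dist L u t) :: real) \<le> (\<Sum>y\<in>A \<inter> Y. of_bool (cw_dist L u y < l))"
        using True by (intro sum_mono) auto
      ultimately have "F t \<ge> 0"
        using bal flow_eq[of u t] u t by simp
      then show ?thesis
        using zl by (simp add: slope_def)
    next
      case False
      then show ?thesis
        using zl by auto
    qed
  qed auto
  finally show ?thesis .
qed

text \<open>Mirror image of \<open>source_arc\<close>: between \<open>l\<close> and the first active
  target behind it only sources are met, so the flow is nonnegative there. The rest of the arc is a
  swap of that target for \<open>v\<close>.\<close>

lemma target_arc:
  assumes v: "v \<in> Y - A" and l: "l \<le> L"
    and bal: "(\<Sum>x\<in>A \<inter> X. of_bool (cw_dist L v x < l) :: real) = (\<Sum>y\<in>A \<inter> Y. of_bool (cw_dist L v y < l))"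
  shows "0 \<le> (\<integral>t. slope F t * of_bool (l \<le> cw_dist L v t) \<partial>circle L)"
proof -
  have vL: "v \<in> {0..<L}"
    using v range by auto
  \<comment> \<open>The default \<open>L\<close> makes the swapped part empty if no active target is
    left on the arc.\<close>
  define R where "R = insert L {z \<in> cw_dist L v ` (A \<inter> Y). l \<le> z}"
  have "finite R"
    using fin by (simp add: R_def)
  define z where "z = Min R"
  have z: "z \<in> R" and zmin: "\<And>y. y \<in> R \<Longrightarrow> z \<le> y"
    using \<open>finite R\<close> unfolding z_def by (intro Min_in, auto simp: R_def)
  have zl: "l \<le> z"
    using z l by (auto simp: R_def)
  have "0 \<le> (\<integral>t. slope F t * of_bool (z \<le> cw_dist L v t) \<partial>circle L)"
  proof (cases "\<exists>b\<in>A \<inter> Y. z = cw_dist L v b")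
    case True
    then show ?thesis
      using swap_target[OF v] by auto
  next
    case False
    then have "z = L"
      using z by (auto simp: R_def)
    then have "(\<integral>t. slope F t * of_bool (z \<le> cw_dist L v t) \<partial>circle L) = (\<integral>t. (0 :: real) \<partial>circle L)"
    proof (intro Bochner_Integration.integral_cong refl)
      fix t assume "t \<in> space (circle L)"
      then show "slope F t * of_bool (z \<le> cw_dist L v t) = 0"
        using cw_dist_range[OF vL, of t] \<open>z = L\<close> by simp
    qed
    then show ?thesis
      by simp
  qed
  also have "\<dots> \<le> (\<integral>t. slope F t * of_bool (l \<le> cw_dist L v t) \<partial>circle L)"
  proof (rule integral_mono)
    fix t assume "t \<in> space (circle L)"
    then have t: "t \<in> {0..<L}"
      by simp
    show "slope F t * of_bool (z \<le> cw_dist L v t) \<le> slope F t * of_bool (l \<le> cw_dist L v t)"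
    proof (cases "l \<le> cw_dist L v t \<and> cw_dist L v t < z")
      case True
      have "(\<Sum>x\<in>A \<inter> X. of_bool (cw_dist L v x < l) :: real) \<le> (\<Sum>x\<in>A \<inter> X. of_bool (cw_dist L v x \<le> cw_dist L v t))"
        using True by (intro sum_mono) auto
      moreover have "(\<Sum>y\<in>A \<inter> Y. of_bool (cw_dist L v y \<le> cw_dist L v t) :: real) \<le> (\<Sum>y\<in>A \<inter> Y. of_bool (cw_dist L v y < l))"
      proof (rule sum_mono)
        fix y assume "y \<in> A \<inter> Y"
        then have "cw_dist L v y \<le> cw_dist L v t \<Longrightarrow> cw_dist L v y < l"
          using zmin[of "cw_dist L v y"] True by (force simp add: R_def)
        then show "(of_bool (cw_dist L v y \<le> cw_dist L v t) :: real) \<le> of_bool (cw_dist L v y < l)"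
          by simp
      qed
      ultimately have "F t \<ge> 0"
        using bal flow_eq[of v t] v t by simp
      then show ?thesis
        using zl by (simp add: slope_def)
    next
      case False
      then show ?thesis
        using zl by auto
    qed
  qed auto
  finally show ?thesis .
qed

end

section \<open>Cells and marginals\<close>

lemma cw_dist_between:
  assumes "u \<in> {0..<L}" "p \<in> {0..<L}" "q \<in> {0..<L}" "t \<in> {0..<L}" "cw_dist L u p \<le> cw_dist L u q"
  shows "cw_dist L p t < cw_dist L p q \<longleftrightarrow> cw_dist L u p \<le> cw_dist L u t \<and> cw_dist L u t < cw_dist L u q"
  using assms by (auto simp: cw_dist_def split: if_splits)

text \<open>The arc from \<open>p\<close> to \<open>v\<close> measured from its endpoint
  \<open>v\<close>, the form in which \<open>target_arc\<close> treats it.\<close>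

lemma cw_dist_after:
  assumes "u \<in> {0..<L}" "p \<in> {0..<L}" "v \<in> {0..<L}" "t \<in> {0..<L}" "cw_dist L u p < cw_dist L u v"
  shows "cw_dist L v p \<le> cw_dist L v t \<longleftrightarrow> cw_dist L u p \<le> cw_dist L u t \<and> cw_dist L u t < cw_dist L u v"
  using assms by (auto simp: cw_dist_def split: if_splits)

text \<open>Up to an integer constant the indicator of the arc is the difference of two coordinate
  steps, as in \<open>geodesic_flow\<close>; the constant accounts for arcs that pass 0.\<close>

lemma of_bool_arc:
  assumes "u \<in> {0..<L}" "v \<in> {0..<L}" "t \<in> {0..<L}"
  shows "(of_bool (cw_dist L u t < cw_dist L u v) :: real) = of_bool (u \<le> t) - of_bool (v \<le> t) + of_bool (v < u)"
  using assms by (auto simp: cw_dist_def)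

lemma line_cost_cw_dist:
  assumes u: "u \<in> {0..<L}" and "finite P" "finite Q" "card P = card Q" "P \<subseteq> {0..<L}" "Q \<subseteq> {0..<L}"
  shows "line_cost w (cw_dist L u ` P) (cw_dist L u ` Q) = w * (\<integral>t. \<bar>(\<Sum>p\<in>P. of_bool (cw_dist L u p \<le> cw_dist L u t)) -
      (\<Sum>q\<in>Q. of_bool (cw_dist L u q \<le> cw_dist L u t))\<bar> \<partial>circle L)"
proof -
  have inj: "inj_on (cw_dist L u) P" "inj_on (cw_dist L u) Q"
    using inj_on_subset[OF cw_dist_inj[OF u]] assms by auto
  have "cw_dist L u p \<in> {0..L}" if "p \<in> {0..<L}" for p
    using cw_dist_range[OF u that] by simp
  then have "cw_dist L u ` P \<subseteq> {0..L}" "cw_dist L u ` Q \<subseteq> {0..L}"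
    using assms(5,6) by blast+
  then show ?thesis
    using assms by (subst line_cost_eq_integral[OF u]) (simp_all add: sum.reindex inj card_image)
qed

lemma line_cost_commute: "card S = card T \<Longrightarrow> line_cost w S T = line_cost w T S"
  by (simp add: line_cost_def abs_minus_commute)

context optimal_flow
begin

lemma inactive_range: "p \<in> X \<union> Y - A \<Longrightarrow> p \<in> {0..<L}"
  and active_range: "a \<in> A \<Longrightarrow> a \<in> {0..<L}"
  using range active by blast+

lemma finite_active [simp]: "finite (A \<inter> X)" "finite (A \<inter> Y)"
  using fin by auto

text \<open>The atoms \<open>u'\<close> and \<open>v'\<close> cut the arc into three pieces, and
  \<open>source_arc\<close> and \<open>target_arc\<close> show that the two outer ones have
  nonnegative integrals.\<close>

lemma cell_below:
  assumes u: "u \<in> X - A" and v: "v \<in> Y - A"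
  obtains u' v' where "u' \<in> X - A" "v' \<in> Y - A" "(u', v') \<in> cells L X Y A"
    "(\<integral>t. slope F t * of_bool (cw_dist L u' t < cw_dist L u' v') \<partial>circle L) \<le>
     (\<integral>t. slope F t * of_bool (cw_dist L u t < cw_dist L u v) \<partial>circle L)"
proof -
  define v' where "v' = arg_min_on (cw_dist L u) (Y - A)"
  have v': "v' \<in> Y - A" and v'_min: "cw_dist L u v' \<le> cw_dist L u y" if "y \<in> Y - A" for y
    unfolding v'_def using fin v that arg_min_if_finite(1)[of "Y - A"] arg_min_least[of "Y - A"] by blast+
  note v' = v'[OF v]
  define S where "S = {x \<in> X - A. cw_dist L u x < cw_dist L u v'}"
  define u' where "u' = arg_min_on (\<lambda>x. - cw_dist L u x) S"
  have L: "u \<in> {0..<L}" "v \<in> {0..<L}" "v' \<in> {0..<L}"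
    using u v v' range by auto
  have "v' \<noteq> u"
    using u v' disj by auto
  then have "u \<in> S"
    using u cw_dist_pos[of u L v'] L by (simp add: S_def)
  moreover have "finite S"
    using fin by (simp add: S_def)
  ultimately have u': "u' \<in> S" and u'_max: "\<And>x. x \<in> S \<Longrightarrow> cw_dist L u x \<le> cw_dist L u u'"
    unfolding u'_def using arg_min_if_finite(1)[of S] arg_min_least[of S _ "\<lambda>x. - cw_dist L u x"] by auto
  have u'XA: "u' \<in> X - A" and less: "cw_dist L u u' < cw_dist L u v'"
    using u' by (auto simp: S_def)
  have u'L: "u' \<in> {0..<L}"
    using u'XA range by auto
  note between = cw_dist_between[OF L(1) u'L L(3) _ less_imp_le[OF less]]
  \<comment> \<open>An inactive target inside the arc would contradict the choice of
    \<open>v'\<close>, an inactive source that of \<open>u'\<close>.\<close>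
  have "(u', v') \<in> cells L X Y A"
  proof -
    have "p \<notin> open_arc L u' v'" if p: "p \<in> X \<union> Y - A" for p
    proof
      assume "p \<in> open_arc L u' v'"
      then have p': "p \<noteq> u'" "cw_dist L u' p < cw_dist L u' v'"
        using less by (auto simp: open_arc_def)
      have pu: "cw_dist L u u' \<le> cw_dist L u p" "cw_dist L u p < cw_dist L u v'"
        using between[OF inactive_range[OF p]] p'(2) by auto
      have "p \<notin> Y"
        using v'_min[of p] pu p by fastforce
      then have "p \<in> S"
        using p pu by (simp add: S_def)
      then have "cw_dist L u p = cw_dist L u u'"
        using u'_max[of p] pu by simp
      then show False
        using inj_onD[OF cw_dist_inj[OF L(1)]] u'L inactive_range[OF p] p'(1) by blast
    qed
    then show ?thesis
      using u'XA v' by (auto simp: cells_def)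
  qed
  moreover have "(\<integral>t. slope F t * of_bool (cw_dist L u' t < cw_dist L u' v') \<partial>circle L) \<le>
     (\<integral>t. slope F t * of_bool (cw_dist L u t < cw_dist L u v) \<partial>circle L)"
  proof -
    have "cw_dist L u v' \<le> cw_dist L u v"
      using v'_min v by simp
    then have "(\<integral>t. slope F t * of_bool (cw_dist L u t < cw_dist L u v) \<partial>circle L) =
       (\<integral>t. slope F t * of_bool (cw_dist L u t < cw_dist L u u') +
             slope F t * of_bool (cw_dist L u' t < cw_dist L u' v') +
             slope F t * of_bool (cw_dist L u v' \<le> cw_dist L u t \<and> cw_dist L u t < cw_dist L u v) \<partial>circle L)"
      using between less by (intro Bochner_Integration.integral_cong) auto
    also have "\<dots> = (\<integral>t. slope F t * of_bool (cw_dist L u t < cw_dist L u u') \<partial>circle L) +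
        (\<integral>t. slope F t * of_bool (cw_dist L u' t < cw_dist L u' v') \<partial>circle L) +
        (\<integral>t. slope F t * of_bool (cw_dist L u v' \<le> cw_dist L u t \<and> cw_dist L u t < cw_dist L u v) \<partial>circle L)"
      by (subst Bochner_Integration.integral_add, simp_all del: of_bool_conj)+
    finally have eq: "(\<integral>t. slope F t * of_bool (cw_dist L u t < cw_dist L u v) \<partial>circle L) = \<dots>" .
    have "0 \<le> (\<integral>t. slope F t * of_bool (cw_dist L u t < cw_dist L u u') \<partial>circle L)"
    proof (rule source_arc[OF u])
      show "0 \<le> cw_dist L u u'"
        using cw_dist_range[OF L(1) u'L] by simp
    qed (use inactive_balanced[of u u'] u u'XA in blast)
    moreover have "0 \<le> (\<integral>t. slope F t * of_bool (cw_dist L u v' \<le> cw_dist L u t \<and> cw_dist L u t < cw_dist L u v) \<partial>circle L)"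
    proof (cases "v' = v")
      \<comment> \<open>The last piece is empty. Measured from \<open>v\<close> as in
        \<open>target_arc\<close> it would be the whole circle, so this case stands apart.\<close>
      case True
      then have "(\<lambda>t. slope F t * of_bool (cw_dist L u v' \<le> cw_dist L u t \<and> cw_dist L u t < cw_dist L u v)) = (\<lambda>_. 0)"
        by (intro ext) simp
      then show ?thesis
        by simp
    next
      case False
      then have "cw_dist L u v' < cw_dist L u v"
        using \<open>cw_dist L u v' \<le> cw_dist L u v\<close> inj_onD[OF cw_dist_inj[OF L(1)] _ L(3,2)] by fastforce
      then have "(\<integral>t. slope F t * of_bool (cw_dist L u v' \<le> cw_dist L u t \<and> cw_dist L u t < cw_dist L u v) \<partial>circle L)
          = (\<integral>t. slope F t * of_bool (cw_dist L v v' \<le> cw_dist L v t) \<partial>circle L)"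
        using cw_dist_after[OF L(1,3,2)] by (intro Bochner_Integration.integral_cong) simp_all
      moreover have "0 \<le> (\<integral>t. slope F t * of_bool (cw_dist L v v' \<le> cw_dist L v t) \<partial>circle L)"
      proof (rule target_arc[OF v])
        show "cw_dist L v v' \<le> L"
          using cw_dist_range[OF L(2,3)] by simp
      qed (use inactive_balanced[of v v'] v v' in blast)
      ultimately show ?thesis
        by simp
    qed
    ultimately show ?thesis
      using eq by linarith
  qed
  ultimately show thesis
    using that u'XA v' by blast
qed

text \<open>The circle is the arc of length \<open>L\<close> from \<open>u\<close>, which is
  balanced because \<open>A\<close> contains \<open>k\<close> sources and \<open>k\<close> targets.
  Hence an additional full turn of flow does not lower the cost.\<close>

lemma integral_slope_nonneg:
  assumes u: "u \<in> X - A"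
  shows "0 \<le> (\<integral>t. slope F t \<partial>circle L)"
proof -
  have uL: "u \<in> {0..<L}"
    using u range by auto
  have "(\<integral>t. slope F t \<partial>circle L) = (\<integral>t. slope F t * of_bool (cw_dist L u t < L) \<partial>circle L)"
    using cw_dist_range[OF uL] by (intro Bochner_Integration.integral_cong) auto
  also have "\<dots> \<ge> 0"
  proof (rule source_arc[OF u])
    have "(\<Sum>a\<in>A \<inter> B. of_bool (cw_dist L u a < L) :: real) = card (A \<inter> B)" for B
      using cw_dist_range[OF uL active_range] by simp
    then show "(\<Sum>x\<in>A \<inter> X. of_bool (cw_dist L u x < L) :: real) = (\<Sum>y\<in>A \<inter> Y. of_bool (cw_dist L u y < L))"
      using cardA by simp
  qed (use uL in simp)
  finally show ?thesis .
qed

text \<open>Convexity bounds the cost from below by linear terms for the arc and for the constant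
  \<open>D\<close>. The latter is nonnegative by \<open>integral_slope_nonneg\<close>, the former is
  reduced to a cell by \<open>cell_below\<close>.\<close>

lemma flow_add_ge:
  assumes u: "u \<in> X - A" and v: "v \<in> Y - A" and D: "D \<ge> 0"
  obtains u' v' where "u' \<in> X - A" "v' \<in> Y - A" "(u', v') \<in> cells L X Y A"
    "(\<integral>t. \<bar>F t\<bar> \<partial>circle L) + (\<integral>t. slope F t * of_bool (cw_dist L u' t < cw_dist L u' v') \<partial>circle L) \<le>
     (\<integral>t. \<bar>F t + (of_bool (cw_dist L u t < cw_dist L u v) + D)\<bar> \<partial>circle L)"
proof -
  have s: "integrable (circle L) (slope F)"
    by (intro integrable_step step_slope)
  obtain u' v' where uv: "u' \<in> X - A" "v' \<in> Y - A" "(u', v') \<in> cells L X Y A"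
    and le: "(\<integral>t. slope F t * of_bool (cw_dist L u' t < cw_dist L u' v') \<partial>circle L) \<le>
     (\<integral>t. slope F t * of_bool (cw_dist L u t < cw_dist L u v) \<partial>circle L)"
    using cell_below[OF u v] .
  have "(\<integral>t. \<bar>F t\<bar> \<partial>circle L) + (\<integral>t. slope F t * of_bool (cw_dist L u t < cw_dist L u v) \<partial>circle L)
      \<le> (\<integral>t. \<bar>F t\<bar> \<partial>circle L) + (\<integral>t. slope F t * of_bool (cw_dist L u t < cw_dist L u v) \<partial>circle L)
        + (\<integral>t. slope F t \<partial>circle L) * D"
    using integral_slope_nonneg[OF u] D by simp
  also have "\<dots> = (\<integral>t. \<bar>F t\<bar> + slope F t * of_bool (cw_dist L u t < cw_dist L u v) + slope F t * D \<partial>circle L)"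
    using s by simp
  also have "\<dots> \<le> (\<integral>t. \<bar>F t + (of_bool (cw_dist L u t < cw_dist L u v) + D)\<bar> \<partial>circle L)"
  proof (rule integral_mono)
    show "integrable (circle L) (\<lambda>t. \<bar>F t\<bar> + slope F t * of_bool (cw_dist L u t < cw_dist L u v) + slope F t * D)"
      using s by simp
    show "integrable (circle L) (\<lambda>t. \<bar>F t + (of_bool (cw_dist L u t < cw_dist L u v) + D)\<bar>)"
      by (intro integrable_abs Bochner_Integration.integrable_add integrable_step step step_of_bool pred_less simple_function_const)
    show "\<bar>F t\<bar> + slope F t * of_bool (cw_dist L u t < cw_dist L u v) + slope F t * D
        \<le> \<bar>F t + (of_bool (cw_dist L u t < cw_dist L u v) + D)\<bar>" for t
      using abs_add_ge_slope[of "of_bool (cw_dist L u t < cw_dist L u v) + D" F t] D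
      by (simp add: distrib_left)
  qed
  finally show thesis
    using that[OF uv] le by linarith
qed

text \<open>For \<open>u = v\<close> the open arc is the circle without \<open>u\<close>, while no
  position lies below \<open>cw_dist L u u\<close>; this is why the endpoints are distinct
  here.\<close>

lemma sum_cell:
  assumes "u \<in> X \<union> Y - A" "v \<in> X \<union> Y - A" "u \<noteq> v" "finite B"
  shows "(\<Sum>a\<in>A \<inter> open_arc L u v \<inter> B. g a) =
      (\<Sum>a\<in>A \<inter> B. g a * of_bool (cw_dist L u a < cw_dist L u v) :: real)"
proof -
  have "a \<in> open_arc L u v \<longleftrightarrow> cw_dist L u a < cw_dist L u v" if "a \<in> A" for a
    using that assms active_range[OF that] by (auto simp: open_arc_def)
  then show ?thesis
    using assms(4) by (intro sum.mono_neutral_cong_left) auto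
qed

lemma cell_balanced:
  assumes "u \<in> X \<union> Y - A" "v \<in> X \<union> Y - A" "u \<noteq> v"
  shows "card (A \<inter> open_arc L u v \<inter> X) = card (A \<inter> open_arc L u v \<inter> Y)"
proof -
  have "real (card (A \<inter> open_arc L u v \<inter> X)) = real (card (A \<inter> open_arc L u v \<inter> Y))"
    using sum_cell[OF assms fin(1), of "\<lambda>_. 1"] sum_cell[OF assms fin(2), of "\<lambda>_. 1"]
      inactive_balanced[OF assms(1,2)] by simp
  then show ?thesis
    by simp
qed

lemma cell_sections:
  assumes u: "u \<in> X - A" and v: "v \<in> Y - A"
  shows "(A \<inter> open_arc L u v \<union> {u, v}) \<inter> X = insert u (A \<inter> open_arc L u v \<inter> X)"
    and "(A \<inter> open_arc L u v \<union> {u, v}) \<inter> Y = insert v (A \<inter> open_arc L u v \<inter> Y)"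
    and "card (insert u (A \<inter> open_arc L u v \<inter> X)) = card (insert v (A \<inter> open_arc L u v \<inter> Y))"
proof -
  show "(A \<inter> open_arc L u v \<union> {u, v}) \<inter> X = insert u (A \<inter> open_arc L u v \<inter> X)"
    "(A \<inter> open_arc L u v \<union> {u, v}) \<inter> Y = insert v (A \<inter> open_arc L u v \<inter> Y)"
    using u v disj by auto
  have "u \<noteq> v"
    using u v disj by auto
  then show "card (insert u (A \<inter> open_arc L u v \<inter> X)) = card (insert v (A \<inter> open_arc L u v \<inter> Y))"
    using cell_balanced[of u v] u v fin by simp
qed

text \<open>On balanced sets the line cost is symmetric. This carries marginals over to the problem
  with sources and targets exchanged.\<close>

lemma marginal_commute:
  assumes u: "u \<in> X - A" and v: "v \<in> Y - A"
  shows "marginal L w Y X A (u, v) = marginal L w X Y A (u, v)"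
proof -
  have uL: "u \<in> {0..<L}"
    using u range by auto
  have "u \<noteq> v"
    using u v disj by auto
  have card_cw: "card (cw_dist L u ` B) = card B" if "B \<subseteq> {0..<L}" for B
    using inj_on_subset[OF cw_dist_inj[OF uL] that] by (rule card_image)
  have "unrolled_cost L w Y X u P = unrolled_cost L w X Y u P" if "card (P \<inter> X) = card (P \<inter> Y)" for P
    unfolding unrolled_cost_def using that
      card_cw[OF le_infI2[OF range(1)], of P] card_cw[OF le_infI2[OF range(2)], of P]
    by (intro line_cost_commute) simp
  then show ?thesis
    using cell_sections[OF u v] cell_balanced[of u v] u v \<open>u \<noteq> v\<close> by simp
qed

text \<open>Within the cell the unrolled active atoms reproduce \<open>F\<close>; from
  \<open>v\<close> on they cancel. Adding \<open>u\<close> at position 0 and \<open>v\<close> at the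
  end of the cell raises this flow by one on the cell, and the integrands of both costs vanish
  outside.\<close>

lemma marginal_eq:
  assumes u: "u \<in> X - A" and v: "v \<in> Y - A"
  shows "marginal L w X Y A (u, v) = w * (\<integral>t. slope F t * of_bool (cw_dist L u t < cw_dist L u v) \<partial>circle L)"
proof -
  have L: "u \<in> {0..<L}" "v \<in> {0..<L}"
    using u v range by auto
  have "u \<noteq> v"
    using u v disj by auto
  let ?P = "A \<inter> open_arc L u v" and ?l = "cw_dist L u v"
  let ?f = "\<lambda>a t. of_bool (cw_dist L u a \<le> cw_dist L u t) :: real"
  have bal: "card (?P \<inter> X) = card (?P \<inter> Y)"
    using cell_balanced[OF _ _ \<open>u \<noteq> v\<close>] u v by blast
  have diff: "(\<Sum>x\<in>?P \<inter> X. ?f x t) - (\<Sum>y\<in>?P \<inter> Y. ?f y t) = F t * of_bool (cw_dist L u t < ?l)"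
    if t: "t \<in> {0..<L}" for t
  proof -
    have "(\<Sum>x\<in>?P \<inter> X. ?f x t) - (\<Sum>y\<in>?P \<inter> Y. ?f y t)
        = (\<Sum>x\<in>A \<inter> X. ?f x t * of_bool (cw_dist L u x < ?l)) - (\<Sum>y\<in>A \<inter> Y. ?f y t * of_bool (cw_dist L u y < ?l))"
      using u v \<open>u \<noteq> v\<close> fin by (subst (1 2) sum_cell) auto
    also have "\<dots> = F t * of_bool (cw_dist L u t < ?l)"
    proof (cases "cw_dist L u t < ?l")
      case True
      then have "(\<Sum>a\<in>B. ?f a t * of_bool (cw_dist L u a < ?l)) = (\<Sum>a\<in>B. ?f a t)" for B
        by (intro sum.cong) auto
      then show ?thesis
        using True flow_eq[of u t] u t by simp
    next
      case False
      then have "(\<Sum>a\<in>B. ?f a t * of_bool (cw_dist L u a < ?l)) = (\<Sum>a\<in>B. of_bool (cw_dist L u a < ?l))" for B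
        by (intro sum.cong) auto
      then show ?thesis
        using False inactive_balanced[of u v] u v by simp
    qed
    finally show ?thesis .
  qed
  have diff': "(\<Sum>x\<in>insert u (?P \<inter> X). ?f x t) - (\<Sum>y\<in>insert v (?P \<inter> Y). ?f y t)
      = F t * of_bool (cw_dist L u t < ?l) + of_bool (cw_dist L u t < ?l)" if t: "t \<in> {0..<L}" for t
    using diff[OF t] u v fin cw_dist_range[OF L(1) t] by (simp add: not_less)
  have fin': "finite (insert u (?P \<inter> X))" "finite (insert v (?P \<inter> Y))" "finite (?P \<inter> X)" "finite (?P \<inter> Y)"
    using fin by auto
  have sub: "insert u (?P \<inter> X) \<subseteq> {0..<L}" "insert v (?P \<inter> Y) \<subseteq> {0..<L}"
    "?P \<inter> X \<subseteq> {0..<L}" "?P \<inter> Y \<subseteq> {0..<L}"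
    using L range by auto
  have "unrolled_cost L w X Y u (?P \<union> {u, v}) =
      w * (\<integral>t. \<bar>F t\<bar> * of_bool (cw_dist L u t < ?l) + slope F t * of_bool (cw_dist L u t < ?l) \<partial>circle L)"
    unfolding unrolled_cost_def cell_sections(1,2)[OF u v]
      line_cost_cw_dist[OF L(1) fin'(1,2) cell_sections(3)[OF u v] sub(1,2)]
  proof (intro arg_cong[where f = "(*) w"] Bochner_Integration.integral_cong refl)
    fix t assume "t \<in> space (circle L)"
    then show "\<bar>(\<Sum>x\<in>insert u (?P \<inter> X). ?f x t) - (\<Sum>y\<in>insert v (?P \<inter> Y). ?f y t)\<bar>
        = \<bar>F t\<bar> * of_bool (cw_dist L u t < ?l) + slope F t * of_bool (cw_dist L u t < ?l)"
      using diff'[of t] abs_add_of_bool_eq_slope[of F t True] flow_Ints[of u t] u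
      by (cases "cw_dist L u t < ?l") auto
  qed
  moreover have "unrolled_cost L w X Y u ?P = w * (\<integral>t. \<bar>F t\<bar> * of_bool (cw_dist L u t < ?l) \<partial>circle L)"
    unfolding unrolled_cost_def line_cost_cw_dist[OF L(1) fin'(3,4) bal sub(3,4)]
    using diff by (intro arg_cong[where f = "(*) w"] Bochner_Integration.integral_cong refl) (simp add: abs_mult)
  moreover have "integrable (circle L) (\<lambda>t. \<bar>F t\<bar> * of_bool (cw_dist L u t < ?l))"
    by (intro integrable_step simple_function_mult step_of_bool pred_less simple_function_compose1[OF step, of abs])
  ultimately show ?thesis
    by (simp add: distrib_left)
qed

text \<open>Counterpart of \<open>flow_le\<close>: unrolled at \<open>u\<close>, the sorted matching
  of \<open>A\<close> costs at most the integral of the absolute flow, which is therefore the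
  minimum of the summed distances over \<open>k\<close> pairs.\<close>

lemma obtain_flow_matching:
  assumes u: "u \<in> X \<union> Y - A"
  obtains M where "is_matching X Y M" "card M = k" "(\<Sum>(x, y)\<in>M. circ_dist L x y) \<le> (\<integral>t. \<bar>F t\<bar> \<partial>circle L)"
proof -
  have uL: "u \<in> {0..<L}"
    using u by (rule inactive_range)
  have sub: "A \<inter> X \<subseteq> {0..<L}" "A \<inter> Y \<subseteq> {0..<L}"
    using range by auto
  have cwr: "cw_dist L u p \<in> {0..L}" if "p \<in> {0..<L}" for p
    using cw_dist_range[OF uL that] by simp
  obtain M where M: "is_matching X Y M" "card M = card (A \<inter> X)"
    "(\<Sum>(x, y)\<in>M. circ_dist L x y) \<le> (\<integral>t. \<bar>(\<Sum>p\<in>A \<inter> X. of_bool (cw_dist L u p \<le> cw_dist L u t)) -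
        (\<Sum>q\<in>A \<inter> Y. of_bool (cw_dist L u q \<le> cw_dist L u t))\<bar> \<partial>circle L)"
  proof (rule obtain_sorted_matching[OF uL, of "A \<inter> X" "A \<inter> Y" X Y "cw_dist L u"])
    show "cw_dist L u ` (A \<inter> X) \<subseteq> {0..L}" "cw_dist L u ` (A \<inter> Y) \<subseteq> {0..L}"
      using cwr sub by blast+
    show "inj_on (cw_dist L u) (A \<inter> X)" "inj_on (cw_dist L u) (A \<inter> Y)"
      using inj_on_subset[OF cw_dist_inj[OF uL]] sub by blast+
    show "circ_dist L p q \<le> \<bar>cw_dist L u p - cw_dist L u q\<bar>" if "p \<in> A \<inter> X" "q \<in> A \<inter> Y" for p q
      using that sub by (intro circ_dist_le_cw_dist uL) auto
  qed (use cardA in auto)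
  have "(\<Sum>(x, y)\<in>M. circ_dist L x y) \<le> (\<integral>t. \<bar>F t\<bar> \<partial>circle L)"
    using flow_eq[OF u]
    by (intro order_trans[OF M(3)] eq_refl Bochner_Integration.integral_cong refl arg_cong[where f = abs]) simp_all
  then show thesis
    using that M cardA by simp
qed

text \<open>Unrolled at \<open>u\<close>, the new source counts everywhere and the new target only
  from its position on, so \<open>F\<close> gains one unit exactly on the arc from \<open>u\<close>
  to \<open>v\<close>.\<close>

lemma obtain_extended_matching:
  assumes u: "u \<in> X - A" and v: "v \<in> Y - A"
  obtains M where "is_matching X Y M" "card M = Suc k" "active_set M = A \<union> {u, v}"
    "(\<Sum>(x, y)\<in>M. circ_dist L x y) \<le> (\<integral>t. \<bar>F t\<bar> \<partial>circle L) +
      (\<integral>t. slope F t * of_bool (cw_dist L u t < cw_dist L u v) \<partial>circle L)"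
proof -
  have uL: "u \<in> {0..<L}"
    using u range by auto
  let ?P = "insert u (A \<inter> X)" and ?Q = "insert v (A \<inter> Y)"
  have sub: "?P \<subseteq> {0..<L}" "?Q \<subseteq> {0..<L}"
    using range u v by auto
  have card: "card ?P = Suc k" "card ?Q = Suc k"
    using u v cardA by simp_all
  have cwr: "cw_dist L u p \<in> {0..L}" if "p \<in> {0..<L}" for p
    using cw_dist_range[OF uL that] by simp
  obtain M where M: "is_matching X Y M" "card M = card ?P" "active_set M = ?P \<union> ?Q"
    "(\<Sum>(x, y)\<in>M. circ_dist L x y) \<le> (\<integral>t. \<bar>(\<Sum>p\<in>?P. of_bool (cw_dist L u p \<le> cw_dist L u t)) -
        (\<Sum>q\<in>?Q. of_bool (cw_dist L u q \<le> cw_dist L u t))\<bar> \<partial>circle L)"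
  proof (rule obtain_sorted_matching[OF uL, of ?P ?Q X Y "cw_dist L u"])
    show "cw_dist L u ` ?P \<subseteq> {0..L}" "cw_dist L u ` ?Q \<subseteq> {0..L}"
      using cwr sub by blast+
    show "inj_on (cw_dist L u) ?P" "inj_on (cw_dist L u) ?Q"
      using inj_on_subset[OF cw_dist_inj[OF uL]] sub by blast+
    show "circ_dist L p q \<le> \<bar>cw_dist L u p - cw_dist L u q\<bar>" if "p \<in> ?P" "q \<in> ?Q" for p q
      using that sub by (intro circ_dist_le_cw_dist uL) auto
    show "?P \<subseteq> X" "?Q \<subseteq> Y"
      using u v by auto
  qed (use card in simp_all)
  have "(\<Sum>p\<in>?P. of_bool (cw_dist L u p \<le> cw_dist L u t)) - (\<Sum>q\<in>?Q. of_bool (cw_dist L u q \<le> cw_dist L u t))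
      = F t + of_bool (cw_dist L u t < cw_dist L u v)" if t: "t \<in> {0..<L}" for t
    using u v flow_eq[of u t] t cw_dist_range[OF uL t] by (simp add: not_less)
  then have "(\<Sum>(x, y)\<in>M. circ_dist L x y) \<le> (\<integral>t. \<bar>F t + of_bool (cw_dist L u t < cw_dist L u v)\<bar> \<partial>circle L)"
    by (intro order_trans[OF M(4)] eq_refl Bochner_Integration.integral_cong refl arg_cong[where f = abs]) simp_all
  moreover have "?P \<union> ?Q = A \<union> {u, v}"
    using active by auto
  ultimately show thesis
    using that[OF M(1)] M card u by (simp add: integral_abs_add_of_bool[of u])
qed

end

section \<open>Geodesic flows of matchings\<close>

text \<open>The clockwise flow of a unit sent from x to y along a geodesic.\<close>

definition winding :: "real \<Rightarrow> real \<Rightarrow> real \<Rightarrow> int" where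
  "winding L x y = (if \<bar>x - y\<bar> \<le> L - \<bar>x - y\<bar> then 0 else if x \<le> y then 1 else - 1)"

definition geodesic_flow :: "real \<Rightarrow> real \<Rightarrow> real \<Rightarrow> real \<Rightarrow> real" where
  "geodesic_flow L x y t = of_bool (x \<le> t) - of_bool (y \<le> t) - of_int (winding L x y)"

lemma step_le: "simple_function (circle L) (\<lambda>t. of_bool (z \<le> t) :: real)"
proof (rule step_of_bool)
  have "(\<lambda>t. t) \<in> borel_measurable (circle L)"
    unfolding circle_def by (rule measurable_restrict_space1) measurable
  then show "Measurable.pred (circle L) (\<lambda>t. z \<le> t)"
    by measurable
qed

lemma step_geodesic_flow: "simple_function (circle L) (geodesic_flow L x y)"
  unfolding geodesic_flow_def[abs_def] by (intro simple_function_diff step_le simple_function_const)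

lemma integral_geodesic_flow:
  assumes "x \<in> {0..<L}" "y \<in> {0..<L}"
  shows "(\<integral>t. \<bar>geodesic_flow L x y t\<bar> \<partial>circle L) = circ_dist L x y"
proof -
  have 0: "0 \<in> {0..<L}"
    using assms by auto
  have I: "(\<integral>t. \<bar>of_bool (x \<le> t) - of_bool (y \<le> t) :: real\<bar> \<partial>circle L) = \<bar>x - y\<bar>"
  proof -
    have "(\<integral>t. \<bar>of_bool (x \<le> t) - of_bool (y \<le> t) :: real\<bar> \<partial>circle L) =
        (\<integral>t. \<bar>of_bool (x \<le> cw_dist L 0 t) - of_bool (y \<le> cw_dist L 0 t) :: real\<bar> \<partial>circle L)"
      by (intro Bochner_Integration.integral_cong) (auto simp: cw_dist_def)
    then show ?thesis
      using integral_abs_diff[OF 0, of x y] assms by simp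
  qed
  show ?thesis
  proof (cases "\<bar>x - y\<bar> \<le> L - \<bar>x - y\<bar>")
    case True
    then show ?thesis
      using I by (simp add: geodesic_flow_def winding_def circ_dist_def)
  next
    case False
    have "integrable (circle L) (\<lambda>t. \<bar>of_bool (x \<le> t) - of_bool (y \<le> t)\<bar> :: real)"
      by (intro integrable_abs Bochner_Integration.integrable_diff integrable_step step_le)
    moreover have "integrable (circle L) (\<lambda>t. 1 :: real)"
      by (intro integrable_step simple_function_const)
    moreover have "(\<integral>t. 1 \<partial>circle L) = L"
    proof -
      have "(\<integral>t. 1 \<partial>circle L) = (\<integral>t. (of_bool (cw_dist L 0 t < L) :: real) \<partial>circle L)"
        by (intro Bochner_Integration.integral_cong) (auto simp: cw_dist_def)
      then show ?thesis
        using integral_less[OF 0, of L] 0 by simp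
    qed
    \<comment> \<open>The geodesic passes 0 here, so the flow is nonzero exactly off the coordinate
      interval between \<open>x\<close> and \<open>y\<close>.\<close>
    moreover have "(\<integral>t. \<bar>geodesic_flow L x y t\<bar> \<partial>circle L) =
        (\<integral>t. 1 - \<bar>of_bool (x \<le> t) - of_bool (y \<le> t)\<bar> \<partial>circle L)"
      using False by (intro Bochner_Integration.integral_cong) (auto simp: geodesic_flow_def winding_def)
    ultimately show ?thesis
      using False I by (simp add: circ_dist_def)
  qed
qed

text \<open>The flow is nonzero at \<open>u\<close> only if the geodesic passes \<open>u\<close>,
  which cuts it into two shorter pieces.\<close>

lemma geodesic_flow_nonzero:
  assumes "x \<in> {0..<L}" "y \<in> {0..<L}" "u \<in> {0..<L}" "u \<noteq> x" "u \<noteq> y" "geodesic_flow L x y u \<noteq> 0"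
  shows "circ_dist L u y < circ_dist L x y" "circ_dist L x u < circ_dist L x y"
  using assms by (auto simp: geodesic_flow_def winding_def circ_dist_def min_def abs_if split: if_splits)

text \<open>The pairing matters only through the total winding: matchings with the same sources and
  targets have flows that differ by an integer constant.\<close>

lemma sum_geodesic_flow:
  assumes "is_matching X Y M"
  shows "(\<Sum>(x, y)\<in>M. geodesic_flow L x y t) =
    (\<Sum>x\<in>fst ` M. of_bool (x \<le> t)) - (\<Sum>y\<in>snd ` M. of_bool (y \<le> t)) - of_int (\<Sum>(x, y)\<in>M. winding L x y)"
proof -
  have "inj_on fst M" "inj_on snd M"
    using assms by (auto simp: is_matching_def)
  then show ?thesis
    by (simp add: geodesic_flow_def case_prod_unfold sum_subtractf sum.reindex)
qed

lemma step_sum_geodesic_flow: "finite M \<Longrightarrow> simple_function (circle L) (\<lambda>t. \<Sum>(x, y)\<in>M. geodesic_flow L x y t)"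
  unfolding case_prod_unfold by (intro simple_function_sum step_geodesic_flow)

text \<open>The triangle inequality: in the net flow, opposite units may cancel.\<close>

lemma integral_sum_geodesic_flow_le:
  assumes "finite M" "M \<subseteq> {0..<L} \<times> {0..<L}"
  shows "(\<integral>t. \<bar>\<Sum>(x, y)\<in>M. geodesic_flow L x y t\<bar> \<partial>circle L) \<le> (\<Sum>(x, y)\<in>M. circ_dist L x y)"
proof -
  have int: "integrable (circle L) (\<lambda>t. \<bar>geodesic_flow L x y t\<bar>)" for x y
    by (intro integrable_abs integrable_step step_geodesic_flow)
  have "(\<integral>t. \<bar>\<Sum>(x, y)\<in>M. geodesic_flow L x y t\<bar> \<partial>circle L)
      \<le> (\<integral>t. (\<Sum>(x, y)\<in>M. \<bar>geodesic_flow L x y t\<bar>) \<partial>circle L)"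
    unfolding case_prod_unfold
    by (intro integral_mono integrable_abs Bochner_Integration.integrable_sum int sum_abs
        integrable_step step_geodesic_flow)
  also have "\<dots> = (\<Sum>(x, y)\<in>M. \<integral>t. \<bar>geodesic_flow L x y t\<bar> \<partial>circle L)"
    unfolding case_prod_unfold using int by (intro Bochner_Integration.integral_sum)
  also have "\<dots> = (\<Sum>(x, y)\<in>M. circ_dist L x y)"
    using assms(2) by (intro sum.cong) (auto simp: integral_geodesic_flow)
  finally show ?thesis .
qed

lemma is_matching_replace:
  assumes M: "is_matching X Y M" "finite M" "(x, y) \<in> M" and xy': "x' \<in> X" "y' \<in> Y"
    and new: "x' \<notin> fst ` M - {x}" "y' \<notin> snd ` M - {y}"
  shows "is_matching X Y (insert (x', y') (M - {(x, y)}))"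
    and "card (insert (x', y') (M - {(x, y)})) = card M"
    and "(\<Sum>(x, y)\<in>insert (x', y') (M - {(x, y)}). c x y) = (\<Sum>(x, y)\<in>M. c x y) - c x y + (c x' y' :: real)"
proof -
  have inj: "inj_on fst M" "inj_on snd M"
    using M by (auto simp: is_matching_def)
  have rm: "fst ` (M - {(x, y)}) = fst ` M - {x}" "snd ` (M - {(x, y)}) = snd ` M - {y}"
    using inj_image_remove[OF inj(1) M(3)] inj_image_remove[OF inj(2) M(3)] by simp_all
  have "is_matching X Y (M - {(x, y)})"
    using M(1) by (rule is_matching_subset) auto
  then show "is_matching X Y (insert (x', y') (M - {(x, y)}))"
    using new xy' unfolding rm[symmetric]
    by (simp add: is_matching_def inj_on_fst_insert inj_on_snd_insert del: inj_on_insert)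
  have notin: "(x', y') \<notin> M - {(x, y)}"
    using new unfolding rm[symmetric] by (metis fst_conv image_eqI)
  then show "card (insert (x', y') (M - {(x, y)})) = card M"
    using M(2) card.remove[OF M(2,3)] by simp
  show "(\<Sum>(x, y)\<in>insert (x', y') (M - {(x, y)}). c x y) = (\<Sum>(x, y)\<in>M. c x y) - c x y + c x' y'"
    using notin M(2) sum.remove[OF M(2,3), of "\<lambda>(x, y). c x y"] by simp
qed

text \<open>A geodesic of an optimal matching cannot pass an inactive atom u: replacing one of its ends
  by u would be cheaper.\<close>

lemma optimal_matching_flow:
  assumes fin: "finite X" "finite Y" and range: "X \<subseteq> {0..<L}" "Y \<subseteq> {0..<L}" and disj: "X \<inter> Y = {}"
    and M: "is_matching X Y M" "card M = k" "active_set M = A"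
    and opt: "\<And>N. is_matching X Y N \<Longrightarrow> card N = k \<Longrightarrow>
      (\<Sum>(x, y)\<in>M. circ_dist L x y) \<le> (\<Sum>(x, y)\<in>N. circ_dist L x y)"
  shows "optimal_flow L X Y A k (\<lambda>t. \<Sum>(x, y)\<in>M. geodesic_flow L x y t)"
proof
  have finM: "finite M"
    using finite_matching[OF fin M(1)] .
  have AX: "A \<inter> X = fst ` M" and AY: "A \<inter> Y = snd ` M"
    using M(3) disj is_matching_fst[OF M(1)] is_matching_snd[OF M(1)] by (auto simp: active_set_def)
  show "A \<subseteq> X \<union> Y"
    using M(3) is_matching_fst[OF M(1)] is_matching_snd[OF M(1)] by (auto simp: active_set_def)
  show card: "card (A \<inter> X) = k" "card (A \<inter> Y) = k"
    using M card_fst_matching[OF M(1)] card_snd_matching[OF M(1)] by (simp_all add: AX AY)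
  show "simple_function (circle L) (\<lambda>t. \<Sum>(x, y)\<in>M. geodesic_flow L x y t)"
    using step_sum_geodesic_flow[OF finM] .
  have "M \<subseteq> {0..<L} \<times> {0..<L}"
    using M(1) range by (auto simp: is_matching_def)
  then show "(\<integral>t. \<bar>\<Sum>(x, y)\<in>M. geodesic_flow L x y t\<bar> \<partial>circle L) \<le> (\<Sum>(x, y)\<in>N. circ_dist L x y)"
    if "is_matching X Y N" "card N = k" for N
    using integral_sum_geodesic_flow_le[OF finM] opt[OF that] by fastforce
  have zero: "geodesic_flow L x y u = 0" if u: "u \<in> X \<union> Y - A" and xy: "(x, y) \<in> M" for u x y
  proof (rule ccontr)
    assume nz: "geodesic_flow L x y u \<noteq> 0"
    have mem: "x \<in> X" "y \<in> Y" "u \<notin> fst ` M" "u \<notin> snd ` M"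
      using xy M(1) u AX AY M(3) by (auto simp: is_matching_def active_set_def)
    have "u \<noteq> x" "u \<noteq> y"
      using mem xy by force+
    then have less: "circ_dist L u y < circ_dist L x y" "circ_dist L x u < circ_dist L x y"
      using geodesic_flow_nonzero[OF _ _ _ _ _ nz] mem u range by blast+
    from u consider "u \<in> X" | "u \<in> Y"
      by auto
    then show False
    proof cases
      case 1
      have "u \<notin> fst ` M - {x}" "y \<notin> snd ` M - {y}"
        using mem by auto
      note r = is_matching_replace[OF M(1) finM xy 1 mem(2) this]
      show ?thesis
        using opt[OF r(1)] r(2) r(3)[of "circ_dist L"] M(2) less by simp
    next
      case 2
      have "x \<notin> fst ` M - {x}" "u \<notin> snd ` M - {y}"
        using mem by auto
      note r = is_matching_replace[OF M(1) finM xy mem(1) 2 this]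
      show ?thesis
        using opt[OF r(1)] r(2) r(3)[of "circ_dist L"] M(2) less by simp
    qed
  qed
  show "(\<Sum>(x, y)\<in>M. geodesic_flow L x y t) =
      (\<Sum>x\<in>A \<inter> X. of_bool (cw_dist L u x \<le> cw_dist L u t)) -
      (\<Sum>y\<in>A \<inter> Y. of_bool (cw_dist L u y \<le> cw_dist L u t))"
    if u: "u \<in> X \<union> Y - A" and t: "t \<in> {0..<L}" for u t
  proof -
    have uL: "u \<in> {0..<L}"
      using u range by auto
    have "(\<Sum>(x, y)\<in>M. geodesic_flow L x y u) = 0"
      using zero[OF u] by (intro sum.neutral) auto
    \<comment> \<open>That the flow vanishes at \<open>u\<close> determines the total winding;
      inserting it makes \<open>u\<close> the base point instead of the coordinate origin.\<close>
    then have at_u: "(\<Sum>x\<in>A \<inter> X. of_bool (x \<le> u)) - (\<Sum>y\<in>A \<inter> Y. of_bool (y \<le> u)) =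
        (of_int (\<Sum>(x, y)\<in>M. winding L x y) :: real)"
      using sum_geodesic_flow[OF M(1), of L u] AX AY by simp
    have base: "(\<Sum>a\<in>A \<inter> B. of_bool (cw_dist L u a \<le> cw_dist L u t) :: real) =
        (\<Sum>a\<in>A \<inter> B. of_bool (a \<le> t)) - (\<Sum>a\<in>A \<inter> B. of_bool (a \<le> u)) + real (card (A \<inter> B)) * of_bool (t < u)"
      if "B \<subseteq> {0..<L}" for B
    proof -
      have "(\<Sum>a\<in>A \<inter> B. of_bool (cw_dist L u a \<le> cw_dist L u t) :: real) =
          (\<Sum>a\<in>A \<inter> B. of_bool (a \<le> t) - of_bool (a \<le> u) + of_bool (t < u))"
      proof (rule sum.cong)
        fix a assume a: "a \<in> A \<inter> B"
        then have "a \<noteq> u" "a \<in> {0..<L}"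
          using u that by auto
        then show "(of_bool (cw_dist L u a \<le> cw_dist L u t) :: real) = of_bool (a \<le> t) - of_bool (a \<le> u) + of_bool (t < u)"
          using of_bool_cw_dist[OF uL _ t, of a] by simp
      qed simp
      then show ?thesis
        by (simp add: sum.distrib sum_subtractf)
    qed
    show ?thesis
      using sum_geodesic_flow[OF M(1), of L t] base[OF range(1)] base[OF range(2)] at_u card
      by (simp add: AX AY)
  qed
qed (use fin range disj in auto)

section \<open>Exchange of sources and targets\<close>

lemma circ_dist_commute: "circ_dist L x y = circ_dist L y x"
  by (simp add: circ_dist_def abs_minus_commute)

lemma is_matching_swap:
  assumes "is_matching X Y M"
  shows "is_matching Y X (prod.swap ` M)" "card (prod.swap ` M) = card M"
    "(\<Sum>(x, y)\<in>prod.swap ` M. circ_dist L x y) = (\<Sum>(x, y)\<in>M. circ_dist L x y)"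
proof -
  have inj: "inj_on prod.swap M"
    by (auto simp: inj_on_def)
  show "is_matching Y X (prod.swap ` M)"
    using assms by (auto simp: is_matching_def inj_on_def)
  show "card (prod.swap ` M) = card M"
    by (rule card_image[OF inj])
  show "(\<Sum>(x, y)\<in>prod.swap ` M. circ_dist L x y) = (\<Sum>(x, y)\<in>M. circ_dist L x y)"
    by (simp add: sum.reindex[OF inj] case_prod_unfold circ_dist_commute)
qed

text \<open>The exchange reverses the direction of the flow. Interpreting the locale again in this
  way covers cells that run from a target to a source, and negative shifts of the flow.\<close>

lemma (in optimal_flow) swap: "optimal_flow L Y X A k (\<lambda>t. - F t)"
proof
  show "(\<integral>t. \<bar>- F t\<bar> \<partial>circle L) \<le> (\<Sum>(x, y)\<in>M. circ_dist L x y)"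
    if "is_matching Y X M" "card M = k" for M
    using flow_le[OF is_matching_swap(1)[OF that(1)]] is_matching_swap(2,3)[OF that(1)] that(2) by simp
  show "simple_function (circle L) (\<lambda>t. - F t)"
    using simple_function_compose1[OF step, of uminus] by simp
  show "- F t = (\<Sum>x\<in>A \<inter> Y. of_bool (cw_dist L u x \<le> cw_dist L u t)) -
      (\<Sum>y\<in>A \<inter> X. of_bool (cw_dist L u y \<le> cw_dist L u t))"
    if "u \<in> Y \<union> X - A" "t \<in> {0..<L}" for u t
    using flow_eq[of u t] that by auto
qed (use fin range disj active cardA in auto)

section \<open>Minimum costs over matchings of a given size\<close>

context
  fixes X Y :: "real set" and L w :: real
  assumes fin: "finite X" "finite Y"
begin

lemma finite_costs: "finite {matching_cost L w M | M. is_matching X Y M \<and> card M = k}"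
proof -
  have "{matching_cost L w M | M. is_matching X Y M \<and> card M = k} \<subseteq> matching_cost L w ` Pow (X \<times> Y)"
    by (auto simp: is_matching_def)
  then show ?thesis
    by (rule finite_subset) (use fin in simp)
qed

lemma opt_cost_le: "is_matching X Y M \<Longrightarrow> card M = k \<Longrightarrow> opt_cost L w X Y k \<le> matching_cost L w M"
  unfolding opt_cost_def by (intro Min_le finite_costs) auto

lemma obtain_opt_matching:
  assumes "is_matching X Y M" "card M = k"
  obtains N where "is_matching X Y N" "card N = k" "matching_cost L w N = opt_cost L w X Y k"
proof -
  have "opt_cost L w X Y k \<in> {matching_cost L w M | M. is_matching X Y M \<and> card M = k}"
    unfolding opt_cost_def using assms by (intro Min_in finite_costs) auto
  then show thesis
    using that by force
qed

lemma opt_matching_le: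
  assumes "w > 0" "matching_cost L w M = opt_cost L w X Y k" "is_matching X Y N" "card N = k"
  shows "(\<Sum>(x, y)\<in>M. circ_dist L x y) \<le> (\<Sum>(x, y)\<in>N. circ_dist L x y)"
  using opt_cost_le[OF assms(3,4)] assms(1) unfolding assms(2)[symmetric] matching_cost_def by simp

end

section \<open>Upper and lower bounds for cells of both orientations\<close>

context optimal_flow
begin

lemma marginal_opposite:
  assumes "(u, v) \<in> candidate_cells L X Y A"
  obtains "u \<in> X - A" "v \<in> Y - A" | "u \<in> Y - A" "v \<in> X - A"
  using assms disj by (auto simp: candidate_cells_def cells_def)

text \<open>The upper bound. A cell from a target to a source is handled in the exchanged problem,
  and the matching found there is turned back by \<open>prod.swap\<close>.\<close>

lemma obtain_cell_matching:
  assumes w: "w > 0" and uv: "(u, v) \<in> candidate_cells L X Y A"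
  obtains M where "is_matching X Y M" "card M = Suc k" "active_set M = A \<union> {u, v}"
    "matching_cost L w M \<le> w * (\<integral>t. \<bar>F t\<bar> \<partial>circle L) + marginal L w X Y A (u, v)"
  using uv
proof (cases rule: marginal_opposite)
  case 1
  obtain M where M: "is_matching X Y M" "card M = Suc k" "active_set M = A \<union> {u, v}"
    "(\<Sum>(x, y)\<in>M. circ_dist L x y) \<le> (\<integral>t. \<bar>F t\<bar> \<partial>circle L) +
      (\<integral>t. slope F t * of_bool (cw_dist L u t < cw_dist L u v) \<partial>circle L)"
    using obtain_extended_matching[OF 1] .
  then show thesis
    using that[OF M(1-3)] marginal_eq[OF 1, of w] w
    by (simp add: matching_cost_def flip: distrib_left del: marginal.simps)
next
  case 2
  interpret s: optimal_flow L Y X A k "\<lambda>t. - F t"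
    by (rule swap)
  obtain M where M: "is_matching Y X M" "card M = Suc k" "active_set M = A \<union> {u, v}"
    "(\<Sum>(x, y)\<in>M. circ_dist L x y) \<le> (\<integral>t. \<bar>- F t\<bar> \<partial>circle L) +
      (\<integral>t. slope (\<lambda>t. - F t) t * of_bool (cw_dist L u t < cw_dist L u v) \<partial>circle L)"
    using s.obtain_extended_matching[OF 2] .
  have "active_set (prod.swap ` M) = A \<union> {u, v}"
    using M(3) by (auto simp: active_set_def image_image)
  then show thesis
    using that[of "prod.swap ` M"] is_matching_swap(1,2)[OF M(1)] is_matching_swap(3)[OF M(1), of L] M(2,4) w
      s.marginal_eq[OF 2, of w] s.marginal_commute[OF 2, of w]
    by (simp add: matching_cost_def flip: distrib_left del: marginal.simps)
qed

text \<open>The lower bound: the flow on the right is that of a matching with \<open>u\<close> and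
  \<open>v\<close> added, whose winding is known only up to an integer \<open>D\<close>. For
  nonnegative \<open>D\<close> the estimate is \<open>flow_add_ge\<close>.\<close>

lemma obtain_cell_le_flow:
  assumes w: "w > 0" and u: "u \<in> X - A" and v: "v \<in> Y - A"
  obtains c where "c \<in> candidate_cells L X Y A"
    "w * (\<integral>t. \<bar>F t\<bar> \<partial>circle L) + marginal L w X Y A c \<le>
     w * (\<integral>t. \<bar>F t + (of_bool (cw_dist L u t < cw_dist L u v) + of_int D)\<bar> \<partial>circle L)"
proof (cases "D \<ge> 0")
  case True
  then obtain u' v' where uv: "u' \<in> X - A" "v' \<in> Y - A" "(u', v') \<in> cells L X Y A"
    "(\<integral>t. \<bar>F t\<bar> \<partial>circle L) + (\<integral>t. slope F t * of_bool (cw_dist L u' t < cw_dist L u' v') \<partial>circle L) \<le>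
     (\<integral>t. \<bar>F t + (of_bool (cw_dist L u t < cw_dist L u v) + of_int D)\<bar> \<partial>circle L)"
    using flow_add_ge[OF u v, of "of_int D"] by auto
  show thesis
    using that[of "(u', v')"] uv w marginal_eq[OF uv(1,2), of w]
    by (simp add: candidate_cells_def flip: distrib_left del: marginal.simps)
next
  \<comment> \<open>Negating the flow turns the arc from \<open>u\<close> to \<open>v\<close> with
    shift \<open>D\<close> into the complementary arc from \<open>v\<close> to \<open>u\<close> with
    the nonnegative shift \<open>- D - 1\<close>.\<close>
  case False
  interpret s: optimal_flow L Y X A k "\<lambda>t. - F t"
    by (rule swap)
  obtain u' v' where uv: "u' \<in> Y - A" "v' \<in> X - A" "(u', v') \<in> cells L Y X A"
    "(\<integral>t. \<bar>- F t\<bar> \<partial>circle L) + (\<integral>t. slope (\<lambda>t. - F t) t * of_bool (cw_dist L u' t < cw_dist L u' v') \<partial>circle L) \<le>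
     (\<integral>t. \<bar>- F t + (of_bool (cw_dist L v t < cw_dist L v u) + of_int (- D - 1))\<bar> \<partial>circle L)"
    using s.flow_add_ge[OF v u, of "of_int (- D - 1)"] False by auto
  have "(\<integral>t. \<bar>- F t + (of_bool (cw_dist L v t < cw_dist L v u) + of_int (- D - 1))\<bar> \<partial>circle L) =
      (\<integral>t. \<bar>F t + (of_bool (cw_dist L u t < cw_dist L u v) + of_int D)\<bar> \<partial>circle L)"
  proof (intro Bochner_Integration.integral_cong refl)
    fix t assume "t \<in> space (circle L)"
    moreover have "u \<noteq> v" "u \<in> {0..<L}" "v \<in> {0..<L}"
      using u v disj range by auto
    ultimately have "of_bool (cw_dist L v t < cw_dist L v u) = 1 - (of_bool (cw_dist L u t < cw_dist L u v) :: real)"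
      using of_bool_arc[of u L v t] of_bool_arc[of v L u t] by auto
    then show "\<bar>- F t + (of_bool (cw_dist L v t < cw_dist L v u) + of_int (- D - 1))\<bar> =
        \<bar>F t + (of_bool (cw_dist L u t < cw_dist L u v) + of_int D)\<bar>"
      by simp
  qed
  moreover have "(u', v') \<in> candidate_cells L X Y A"
    using uv by (auto simp: candidate_cells_def cells_def Un_commute)
  ultimately show thesis
    using that[of "(u', v')"] uv w s.marginal_eq[OF uv(1,2), of w] s.marginal_commute[OF uv(1,2), of w]
    by (simp flip: distrib_left del: marginal.simps)
qed

end

section \<open>The increment of the optimal cost and the cells that attain it\<close>

theorem theorem3:
  fixes L w :: real and n m k :: nat and X Y A :: "real set"
  assumes "L > 0" and "w > 0" and "n \<ge> 1" and "m \<ge> 1"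
    and "finite X" and "card X = n" and "X \<subseteq> {0..<L}"
    and "finite Y" and "card Y = m" and "Y \<subseteq> {0..<L}"
    and "X \<inter> Y = {}"
    and "k < min n m"
    and "circ_optimal L w X Y k A"
    and "cell_selection L X Y k A"
  shows "opt_cost L w X Y (k + 1) - opt_cost L w X Y k =
           Min (marginal L w X Y A ` candidate_cells L X Y A) \<and>
         (\<forall>(u, v) \<in> candidate_cells L X Y A.
            marginal L w X Y A (u, v) = Min (marginal L w X Y A ` candidate_cells L X Y A) \<longrightarrow>
            circ_optimal L w X Y (k + 1) (A \<union> {u, v}))"
proof -
  note fin = \<open>finite X\<close> \<open>finite Y\<close> and w = \<open>w > 0\<close>
  obtain M where M: "is_matching X Y M" "card M = k" "active_set M = A"
    and M_opt: "matching_cost L w M = opt_cost L w X Y k"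
    using \<open>circ_optimal L w X Y k A\<close> by (auto simp: circ_optimal_def)
  define F where "F t = (\<Sum>(x, y)\<in>M. geodesic_flow L x y t)" for t
  interpret optimal_flow L X Y A k F
    unfolding F_def using assms M opt_matching_le[OF fin w M_opt]
    by (intro optimal_matching_flow) auto
  have AX: "A \<inter> X = fst ` M" and AY: "A \<inter> Y = snd ` M"
    using M(3) disj is_matching_fst[OF M(1)] is_matching_snd[OF M(1)] by (auto simp: active_set_def)
  have "X - A \<noteq> {}" "Y - A \<noteq> {}"
    using card_mono[of "A \<inter> X" X] card_mono[of "A \<inter> Y" Y] cardA assms(6,9,12)
      Int_absorb1[of X A] Int_absorb1[of Y A] by auto
  then obtain u0 v0 where u0: "u0 \<in> X - A" and v0: "v0 \<in> Y - A"
    by blast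
  have cost_k: "w * (\<integral>t. \<bar>F t\<bar> \<partial>circle L) = opt_cost L w X Y k"
  proof (rule antisym)
    show "w * (\<integral>t. \<bar>F t\<bar> \<partial>circle L) \<le> opt_cost L w X Y k"
      using flow_le[OF M(1,2)] w unfolding M_opt[symmetric] by (simp add: matching_cost_def)
    obtain N where N: "is_matching X Y N" "card N = k" "(\<Sum>(x, y)\<in>N. circ_dist L x y) \<le> (\<integral>t. \<bar>F t\<bar> \<partial>circle L)"
      using obtain_flow_matching[of u0] u0 by blast
    then show "opt_cost L w X Y k \<le> w * (\<integral>t. \<bar>F t\<bar> \<partial>circle L)"
      using opt_cost_le[OF fin N(1,2), of L w] w by (simp add: matching_cost_def order_trans)
  qed
  let ?C = "candidate_cells L X Y A" and ?m = "marginal L w X Y A"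
  have upper: "opt_cost L w X Y (Suc k) \<le> opt_cost L w X Y k + ?m c" if c: "c \<in> ?C" for c
  proof -
    obtain u v where [simp]: "c = (u, v)"
      by (cases c)
    obtain N where N: "is_matching X Y N" "card N = Suc k"
      "matching_cost L w N \<le> w * (\<integral>t. \<bar>F t\<bar> \<partial>circle L) + ?m (u, v)"
      using obtain_cell_matching[OF w, of u v] c by auto
    then show ?thesis
      using opt_cost_le[OF fin N(1,2), of L w] cost_k by (simp del: marginal.simps)
  qed
  \<comment> \<open>Some optimal matching of \<open>Suc k\<close> pairs activates just
    \<open>u\<close> and \<open>v\<close> in addition to \<open>A\<close>; its flow yields a cell
    whose marginal is at most the increment.\<close>
  obtain c where c: "c \<in> ?C" and lower: "opt_cost L w X Y k + ?m c \<le> opt_cost L w X Y (Suc k)"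
  proof -
    obtain M0 where "is_matching X Y M0" "card M0 = Suc k"
      using obtain_extended_matching[OF u0 v0] by blast
    then obtain N where N: "is_matching X Y N" "card N = Suc k"
      and N_opt: "matching_cost L w N = opt_cost L w X Y (Suc k)"
      using obtain_opt_matching[OF fin, of M0 "Suc k" L w] by blast
    obtain M' u v where M': "is_matching X Y M'" "card M' = Suc k"
      "(\<Sum>(x, y)\<in>M'. circ_dist L x y) = (\<Sum>(x, y)\<in>N. circ_dist L x y)"
      and uv: "u \<in> X - fst ` M" "v \<in> Y - snd ` M"
      and ins: "fst ` M' = insert u (fst ` M)" "snd ` M' = insert v (snd ` M)"
      using optimal_matching_extends[OF fin M(1,2) opt_matching_le[OF fin w M_opt] N opt_matching_le[OF fin w N_opt]] .
    have uvA: "u \<in> X - A" "v \<in> Y - A"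
      using uv AX AY by auto
    have uvL: "u \<in> {0..<L}" "v \<in> {0..<L}"
      using uvA range by auto
    \<comment> \<open>The integer by which the flows differ apart from the arc: the change of the
      total winding, corrected by the term of \<open>of_bool_arc\<close> for an arc that passes
      0.\<close>
    define D where "D = (\<Sum>(x, y)\<in>M. winding L x y) - (\<Sum>(x, y)\<in>M'. winding L x y) - of_bool (v < u)"
    have flow': "(\<Sum>(x, y)\<in>M'. geodesic_flow L x y t) = F t + (of_bool (cw_dist L u t < cw_dist L u v) + of_int D)"
      if t: "t \<in> {0..<L}" for t
    proof -
      have "finite (fst ` M)" "finite (snd ` M)"
        using finite_active by (simp_all add: AX AY)
      then show ?thesis
        unfolding F_def sum_geodesic_flow[OF M(1)] sum_geodesic_flow[OF M'(1)] ins D_def of_bool_arc[OF uvL t]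
        using uv by simp
    qed
    obtain c where "c \<in> ?C" "w * (\<integral>t. \<bar>F t\<bar> \<partial>circle L) + ?m c \<le>
        w * (\<integral>t. \<bar>F t + (of_bool (cw_dist L u t < cw_dist L u v) + of_int D)\<bar> \<partial>circle L)"
      using obtain_cell_le_flow[OF w uvA] .
    moreover have "(\<integral>t. \<bar>F t + (of_bool (cw_dist L u t < cw_dist L u v) + of_int D)\<bar> \<partial>circle L)
        = (\<integral>t. \<bar>\<Sum>(x, y)\<in>M'. geodesic_flow L x y t\<bar> \<partial>circle L)"
      using flow' by (intro Bochner_Integration.integral_cong) simp_all
    moreover have "\<dots> \<le> (\<Sum>(x, y)\<in>M'. circ_dist L x y)"
      using finite_matching[OF fin M'(1)] M'(1) range
      by (intro integral_sum_geodesic_flow_le) (auto simp: is_matching_def)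
    moreover have "opt_cost L w X Y (Suc k) = w * (\<Sum>(x, y)\<in>M'. circ_dist L x y)"
      using M'(3) N_opt by (simp add: matching_cost_def)
    ultimately show thesis
      using that[of c] w cost_k by (smt (verit) mult_le_cancel_left_pos)
  qed
  have "?C \<subseteq> (X \<union> Y) \<times> (X \<union> Y)"
    by (auto simp: candidate_cells_def cells_def)
  then have finC: "finite ?C"
    by (rule finite_subset) (use fin in simp)
  have min: "opt_cost L w X Y (Suc k) - opt_cost L w X Y k = Min (?m ` ?C)"
  proof (rule antisym)
    show "opt_cost L w X Y (Suc k) - opt_cost L w X Y k \<le> Min (?m ` ?C)"
      using finC c upper by (subst Min_ge_iff) (auto simp: algebra_simps simp del: marginal.simps)
    have "Min (?m ` ?C) \<le> ?m c"
      using finC c by simp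
    then show "Min (?m ` ?C) \<le> opt_cost L w X Y (Suc k) - opt_cost L w X Y k"
      using lower by simp
  qed
  have "circ_optimal L w X Y (Suc k) (A \<union> {u, v})" if uv: "(u, v) \<in> ?C" and eq: "?m (u, v) = Min (?m ` ?C)" for u v
  proof -
    obtain N where N: "is_matching X Y N" "card N = Suc k" "active_set N = A \<union> {u, v}"
      and le: "matching_cost L w N \<le> w * (\<integral>t. \<bar>F t\<bar> \<partial>circle L) + ?m (u, v)"
      using obtain_cell_matching[OF w uv] .
    \<comment> \<open>For a minimizing cell the upper bound equals the optimum by
      \<open>min\<close>, so the matching found for the cell attains it.\<close>
    have "matching_cost L w N = opt_cost L w X Y (Suc k)"
      using opt_cost_le[OF fin N(1,2), of L w] le min eq cost_k by (simp del: marginal.simps)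
    moreover have "active_set N \<inter> X = fst ` N" "active_set N \<inter> Y = snd ` N" "active_set N \<subseteq> X \<union> Y"
      using disj is_matching_fst[OF N(1)] is_matching_snd[OF N(1)] by (auto simp: active_set_def)
    ultimately show ?thesis
      using N card_fst_matching[OF N(1)] card_snd_matching[OF N(1)] unfolding circ_optimal_def by metis
  qed
  then show ?thesis
    using min by (auto simp del: marginal.simps)
qed

end
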